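(* Let $n,p,T\geq 1$ be integers, let $X\in\mathbb{R}^{n\times p}$ be a nonzero matrix, let $A_0\in\mathbb{R}^{p\times T}$ and $E\in\mathbb{R}^{n\times T}$ be arbitrary matrices, and set $Y=XA_0+E$. Let $\mu>0$ be such that $$\sigma_{\mathrm{rank}(X)}(X)\geq \frac{1}{\mu}.$$ Let $\lambda\geq 2\sigma_1(X^TE)$ and let $\widehat A_\lambda$ be a minimizer $$\widehat A_\lambda\in\mathop{\mathrm{argmin}}_{A\in\mathbb{R}^{p\times T}}\Big\{\|Y-XA\|^2+\lambda\sum_k\sigma_k(A)\Big\}.$$ Then $$\|X\widehat A_\lambda-XA_0\|^2\leq \inf_{A\in\mathbb{R}^{p\times T}}\Big\{\|XA-XA_0\|^2+\frac32\,\mu^2\lambda^2\,\mathrm{rank}(A)\Big\}=\inf_{r}\Big\{\sum_{k\geq r+1}\sigma_k(XA_0)^2+\frac32\,\mu^2\lambda^2 r\Big\},$$ where $r$ ranges over the integers $0\leq r\leq\min(p,T)$.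
   Context: For a real matrix $M$, $\sigma_1(M)\geq\sigma_2(M)\geq\cdots\geq 0$ denote its singular values in nonincreasing order (with $\sigma_k(M)=0$ for $k$ larger than the number of rows or columns of $M$), $M^T$ is its transpose, and $\|M\|$ is its Hilbert-Schmidt (Frobenius) norm, $\|M\|^2=\mathrm{tr}(M^TM)=\sum_k\sigma_k(M)^2$. Thus $\sigma_{\mathrm{rank}(X)}(X)$ is the smallest positive singular value of $X$, and no relation between $n$ and $p$ is assumed. The statement is deterministic. *)

theory Defs
  imports "HOL-Analysis.Analysis" "HOL-Library.Multiset"
begin

definition eigenspace :: "real^'m^'m \<Rightarrow> real \<Rightarrow> (real^'m) set"
  where "eigenspace S t = {v. S *v v = t *\<^sub>R v}"

definition eigenvalues :: "real^'m^'m \<Rightarrow> real set"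
  where "eigenvalues S = {t. \<exists>v. v \<noteq> 0 \<and> S *v v = t *\<^sub>R v}"

text \<open>
  The square roots of the eigenvalues of $M^T M$, each repeated according to its multiplicity.
  Since $M^T M$ is symmetric, the dimension of the eigenspace is the multiplicity, and
  the index set of the sum is finite (lemma \<open>finite_eigenvalues_gram\<close>).
\<close>

definition singular_value_mset :: "real^'c^'r \<Rightarrow> real multiset"
  where "singular_value_mset M =
    (\<Sum>t\<in>eigenvalues (transpose M ** M).
       replicate_mset (dim (eigenspace (transpose M ** M) t)) (sqrt t))"

text \<open>
  The index \<open>k\<close> starts at 1, the largest singular value.  The list below has length \<open>CARD('c)\<close>.
\<close>

definition singular_value :: "real^'c^'r \<Rightarrow> nat \<Rightarrow> real"
  where "singular_value M k =
    (if 1 \<le> k \<and> k \<le> min CARD('r) CARD('c)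
     then rev (sorted_list_of_multiset (singular_value_mset M)) ! (k - 1)
     else 0)"

lemma finite_eigenvalues_gram:
  fixes M :: "real^'c^'r"
  shows "finite (eigenvalues (transpose M ** M))"
proof -
  let ?S = "transpose M ** M"
  let ?E = "eigenvalues ?S"
  define w where "w t = (SOME v. v \<noteq> 0 \<and> ?S *v v = t *\<^sub>R v)" for t
  have w: "w t \<noteq> 0 \<and> ?S *v w t = t *\<^sub>R w t" if "t \<in> ?E" for t
    unfolding w_def by (rule someI_ex) (use that in \<open>simp add: eigenvalues_def\<close>)
  have sym: "(?S *v x) \<bullet> y = x \<bullet> (?S *v y)" for x y
    by (metis dot_lmul_matrix matrix_transpose_mul transpose_transpose
        vector_transpose_matrix)
  have orth: "w s \<bullet> w t = 0" if "s \<in> ?E" "t \<in> ?E" "s \<noteq> t" for s t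
    using sym[of "w s" "w t"] w[OF that(1)] w[OF that(2)] that(3) by simp
  have inj: "inj_on w ?E"
    by (rule inj_onI) (metis orth w inner_eq_zero_iff)
  have "pairwise orthogonal (w ` ?E)"
    by (auto simp: pairwise_def orthogonal_def intro: orth)
  moreover have "0 \<notin> w ` ?E"
    using w by force
  ultimately have "independent (w ` ?E)"
    by (rule pairwise_orthogonal_independent)
  then show ?thesis
    using inj finite_imageD independent_imp_finite by blast
qed

text \<open>The library norm on matrices is the Hilbert-Schmidt (Frobenius) norm.\<close>

lemma norm_matrix_eq_trace:
  fixes M :: "real^'c^'r"
  shows "(norm M)\<^sup>2 = trace (transpose M ** M)"
proof -
  have "(norm M)\<^sup>2 = (\<Sum>i\<in>UNIV. \<Sum>j\<in>UNIV. M $ i $ j * M $ i $ j)"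
    by (simp add: power2_norm_eq_inner inner_vec_def)
  also have "\<dots> = (\<Sum>j\<in>UNIV. \<Sum>i\<in>UNIV. M $ i $ j * M $ i $ j)"
    by (rule sum.swap)
  also have "\<dots> = trace (transpose M ** M)"
    by (simp add: trace_def matrix_matrix_mult_def transpose_def)
  finally show ?thesis .
qed

end

theory Submission
  imports Defs
begin

text \<open>
  The penalized estimator may be replaced by its projection onto the row space of X, which is
  again a minimizer with the same fitted values; there the Frobenius norm of a matrix D is at most
  \<open>\<mu>\<close> times that of XD.  Since the nuclear norm N is convex, minimality of the estimator Ah
  gives, with \<open>D = Ah - A\<close>,
  \<open>2 \<langle>XAh - XA0, XD\<rangle> \<le> lam (N A - N (A + D)) + 2 \<langle>X\<^sup>T E, D\<rangle>\<close>.
  Bounding N (A + D) from below by a subgradient at A that is aligned with the block of D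
  orthogonal to the row and column spaces of A absorbs the noise in that block, and the remaining
  part has rank at most 2 rank(A): the right-hand side is at most
  \<open>(1 + sqrt 2) sqrt (rank A) lam \<parallel>D\<parallel>\<close>, and \<open>(1 + sqrt 2)\<^sup>2 \<le> 6\<close>.  Polarizing the
  left-hand side and completing the square gives the oracle inequality.  The equality of the two
  infima is the Eckart-Young theorem, where the best approximation of \<open>XA0\<close> of rank r is
  again of the form XA because truncating the singular value decomposition is multiplication from
  the right.
\<close>

section \<open>Spectral theorem for Gram matrices\<close>

lemma gram_inner:
  fixes M :: "real^'c^'r"
  shows "x \<bullet> ((transpose M ** M) *v y) = (M *v x) \<bullet> (M *v y)"
  by (metis dot_lmul_matrix inner_commute matrix_vector_mul_assoc vector_transpose_matrix)

text \<open>First-order optimality in elementary form: for \<open>a > 0\<close> the linear term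
  would beat the quadratic one at a small positive \<open>s\<close>, here \<open>a / d\<close> with
  \<open>d > c\<close>.\<close>

lemma nonpos_if_linear_le_quadratic:
  fixes a c :: real
  assumes "\<And>s. s * a \<le> s\<^sup>2 * c"
  shows "a \<le> 0"
proof (rule ccontr)
  assume "\<not> a \<le> 0"
  then have a: "a > 0" by simp
  define d where "d = \<bar>c\<bar> + 1"
  have d: "d > 0" "c < d" by (auto simp: d_def)
  have "(a / d) * a \<le> (a / d)\<^sup>2 * c" by (rule assms)
  also have "\<dots> < (a / d)\<^sup>2 * d" using a d by (intro mult_strict_left_mono) auto
  also have "\<dots> = (a / d) * a" using d by (simp add: power2_eq_square)
  finally show False by simp
qed

text \<open>Otherwise the orthogonal complement \<open>U\<close> of all eigenvectors is nonzero, and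
  it is invariant under \<open>S\<close> by symmetry. The quadratic form of \<open>S\<close> attains
  a maximum on the compact unit sphere of \<open>U\<close>; the maximizer is an eigenvector lying in
  \<open>U\<close>, hence orthogonal to itself.\<close>

lemma span_eigenspaces_symmetric:
  fixes S :: "real^'m^'m"
  assumes sym: "\<And>x y. (S *v x) \<bullet> y = x \<bullet> (S *v y)"
  shows "span (\<Union>t\<in>eigenvalues S. eigenspace S t) = UNIV"
proof (rule ccontr)
  define F where "F = (\<Union>t\<in>eigenvalues S. eigenspace S t)"
  have F: "x \<in> F" if "S *v x = t *\<^sub>R x" "x \<noteq> 0" for x t
    using that by (auto simp: F_def eigenvalues_def eigenspace_def)
  assume "span (\<Union>t\<in>eigenvalues S. eigenspace S t) \<noteq> UNIV"
  then obtain a where a: "a \<noteq> 0" "\<forall>x\<in>span F. a \<bullet> x = 0"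
    using span_not_UNIV_orthogonal[of F] unfolding F_def by blast
  define U where "U = {x. \<forall>y\<in>F. y \<bullet> x = 0}"
  have U: "subspace U"
    by (auto simp: U_def subspace_def inner_add_right)
  have US: "S *v x \<in> U" if "x \<in> U" for x
  proof -
    have "y \<bullet> (S *v x) = 0" if "y \<in> F" for y
    proof -
      obtain t where "S *v y = t *\<^sub>R y" using \<open>y \<in> F\<close> by (auto simp: F_def eigenspace_def)
      then show ?thesis using sym[of y x] \<open>x \<in> U\<close> that by (simp add: U_def)
    qed
    then show ?thesis by (simp add: U_def)
  qed
  have aU: "a /\<^sub>R norm a \<in> U \<inter> sphere 0 1"
    using a by (auto simp: U_def inner_commute span_base)
  have "compact (U \<inter> sphere 0 1)"
    using closed_subspace[OF U] by (intro closed_Int_compact) auto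
  moreover have "continuous_on (U \<inter> sphere 0 1) (\<lambda>x. x \<bullet> (S *v x))"
    by (intro continuous_on_inner continuous_on_id matrix_vector_mult_linear_continuous_on)
  ultimately obtain e where e: "e \<in> U" "norm e = 1"
      and max: "\<And>x. x \<in> U \<Longrightarrow> norm x = 1 \<Longrightarrow> x \<bullet> (S *v x) \<le> e \<bullet> (S *v e)"
    using continuous_attains_sup[of "U \<inter> sphere 0 1" "\<lambda>x. x \<bullet> (S *v x)"] aU by fastforce
  define m where "m = e \<bullet> (S *v e)"
  have le: "y \<bullet> (S *v y) \<le> m * (y \<bullet> y)" if "y \<in> U" for y
  proof (cases "y = 0")
    case False
    have "(y /\<^sub>R norm y) \<bullet> (S *v (y /\<^sub>R norm y)) \<le> m"
      unfolding m_def using False that by (intro max) (auto simp: subspace_scale[OF U])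
    then have "(y \<bullet> (S *v y)) / (norm y)\<^sup>2 \<le> m"
      by (simp add: matrix_vector_mult_scaleR power2_eq_square field_simps)
    then show ?thesis
      using False by (simp add: divide_le_eq power2_norm_eq_inner)
  qed simp
  define z where "z = S *v e - m *\<^sub>R e"
  have zU: "z \<in> U"
    unfolding z_def using e US U by (auto intro: subspace_diff subspace_scale)
  have ee: "e \<bullet> e = 1" using e by (simp add: norm_eq_1)
  \<comment> \<open>The residual \<open>z\<close> is itself the direction of variation: the
    derivative of \<open>x \<bullet> (S *v x) - m * (x \<bullet> x)\<close> at \<open>e\<close>
    along \<open>z\<close> is \<open>2 * (z \<bullet> z)\<close>, and it cannot be positive at a
    maximum.\<close>
  have "2 * (z \<bullet> z) \<le> 0"
  proof (rule nonpos_if_linear_le_quadratic)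
    fix s :: real
    have "e + s *\<^sub>R z \<in> U" using zU e U by (auto intro: subspace_add subspace_scale)
    from le[OF this]
    have "m + s * (2 * (z \<bullet> (S *v e))) + s\<^sup>2 * (z \<bullet> (S *v z))
          \<le> m + s * (2 * (m * (z \<bullet> e))) + s\<^sup>2 * (m * (z \<bullet> z))"
      using sym[of e z]
      by (simp add: inner_add_left inner_add_right matrix_vector_right_distrib
          matrix_vector_mult_scaleR m_def[symmetric] ee inner_commute power2_eq_square algebra_simps)
    then show "s * (2 * (z \<bullet> z)) \<le> s\<^sup>2 * (m * (z \<bullet> z) - z \<bullet> (S *v z))"
      by (subst (2) z_def) (simp add: inner_diff_right algebra_simps)
  qed
  then have "z = 0" using inner_ge_zero[of z] inner_eq_zero_iff[of z] by linarith
  moreover have "e \<noteq> 0" using e by auto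
  ultimately have "e \<in> F" using F[of e m] by (simp add: z_def)
  then show False using e ee by (auto simp: U_def)
qed

text \<open>Orthonormal bases of the eigenspaces of the Gram matrix are united. Since
  \<open>norm (M *v x)\<close> is \<open>sqrt t\<close> for a unit eigenvector \<open>x\<close> with
  eigenvalue \<open>t\<close>, the basis vectors reproduce the singular values with their
  multiplicities.\<close>

lemma gram_eigenvector_basis:
  fixes M :: "real^'c^'r"
  obtains B :: "(real^'c) set"
  where "finite B" "card B = CARD('c)" "\<And>x y. x \<in> B \<Longrightarrow> y \<in> B \<Longrightarrow> x \<bullet> y = (if x = y then 1 else 0)"
    and "\<And>x y. x \<in> B \<Longrightarrow> y \<in> B \<Longrightarrow> x \<noteq> y \<Longrightarrow> (M *v x) \<bullet> (M *v y) = 0"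
    and "image_mset (\<lambda>x. norm (M *v x)) (mset_set B) = singular_value_mset M"
proof -
  let ?S = "transpose M ** M"
  let ?T = "eigenvalues ?S"
  have sym: "(?S *v x) \<bullet> y = x \<bullet> (?S *v y)" for x y
    by (metis gram_inner inner_commute)
  have "subspace (eigenspace ?S t)" for t
    by (auto simp: subspace_def eigenspace_def matrix_vector_right_distrib
        matrix_vector_mult_scaleR scaleR_add_right)
  then have "\<exists>B. B \<subseteq> eigenspace ?S t \<and> pairwise orthogonal B \<and> (\<forall>x\<in>B. norm x = 1) \<and>
      independent B \<and> card B = dim (eigenspace ?S t) \<and> span B = eigenspace ?S t" for t
    by (metis orthonormal_basis_subspace)
  then obtain b where b: "\<And>t. b t \<subseteq> eigenspace ?S t" "\<And>t. pairwise orthogonal (b t)"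
      "\<And>t x. x \<in> b t \<Longrightarrow> norm x = 1" "\<And>t. independent (b t)"
      "\<And>t. card (b t) = dim (eigenspace ?S t)" "\<And>t. span (b t) = eigenspace ?S t"
    by metis
  have fin: "finite (b t)" for t using b(4) independent_imp_finite by blast
  have eig: "?S *v x = t *\<^sub>R x" if "x \<in> b t" for x t
    using b(1) that by (auto simp: eigenspace_def)
  define B where "B = (\<Union>t\<in>?T. b t)"
  have finB: "finite B" using fin finite_eigenvalues_gram by (auto simp: B_def)
  \<comment> \<open>A nonzero vector has only one eigenvalue, so the bases are disjoint and no
    multiplicity is lost in the union.\<close>
  have disj: "s = t" if "x \<in> b s" "x \<in> b t" for x s t
    using eig[OF that(1)] eig[OF that(2)] b(3)[OF that(1)] by auto
  have on: "x \<bullet> y = (if x = y then 1 else 0)" if "x \<in> B" "y \<in> B" for x y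
  proof -
    obtain s t where st: "x \<in> b s" "y \<in> b t" using \<open>x \<in> B\<close> \<open>y \<in> B\<close> by (auto simp: B_def)
    have "x \<bullet> x = 1" using b(3)[OF st(1)] by (simp add: norm_eq_1)
    moreover have "x \<bullet> y = 0" if "x \<noteq> y"
    proof (cases "s = t")
      case True
      then show ?thesis using b(2)[of s] st that by (auto simp: pairwise_def orthogonal_def)
    next
      case False
      then show ?thesis using sym[of x y] eig[OF st(1)] eig[OF st(2)] by simp
    qed
    ultimately show ?thesis by auto
  qed
  have orthM: "(M *v x) \<bullet> (M *v y) = 0" if xy: "x \<in> B" "y \<in> B" "x \<noteq> y" for x y
  proof -
    obtain t where t: "y \<in> b t" using xy by (auto simp: B_def)
    show ?thesis
      using gram_inner[of x M y] eig[OF t] on[OF xy(1,2)] xy(3) by simp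
  qed
  have "pairwise orthogonal B" "0 \<notin> B"
    using on by (auto simp: pairwise_def orthogonal_def)
      (metis inner_zero_left zero_neq_one)
  then have ind: "independent B" by (rule pairwise_orthogonal_independent)
  have "eigenspace ?S t \<subseteq> span B" if "t \<in> ?T" for t
    using b(6)[of t] span_mono[of "b t" B] that by (auto simp: B_def)
  then have "span (\<Union>t\<in>?T. eigenspace ?S t) \<subseteq> span B"
    by (metis (no_types, lifting) UN_least span_mono span_span)
  then have "span B = UNIV"
    using span_eigenspaces_symmetric[of ?S] sym by auto
  then have card: "card B = CARD('c)"
    using dim_eq_card_independent[OF ind] dim_span[of B] by simp
  have nrm: "norm (M *v x) = sqrt t" if "x \<in> b t" for x t
    using gram_inner[of x M x] eig[OF that] b(3)[OF that]
    by (simp add: norm_eq_sqrt_inner)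
  have "image_mset (\<lambda>x. norm (M *v x)) (mset_set B) = (\<Sum>x\<in>B. {#norm (M *v x)#})"
    using finB by (induction B) auto
  also have "\<dots> = (\<Sum>t\<in>?T. \<Sum>x\<in>b t. {#norm (M *v x)#})"
    unfolding B_def using fin finite_eigenvalues_gram disj
    by (intro sum.UNION_disjoint) auto
  also have "\<dots> = (\<Sum>t\<in>?T. \<Sum>x\<in>b t. {#sqrt t#})"
    by (intro sum.cong refl) (simp add: nrm)
  also have "\<dots> = singular_value_mset M"
    unfolding singular_value_mset_def
  proof (rule sum.cong[OF refl])
    fix t
    have "(\<Sum>x\<in>C. {#sqrt t#}) = replicate_mset (card C) (sqrt t)" if "finite C" for C :: "(real^'c) set"
      using that by (induction C) auto
    then show "(\<Sum>x\<in>b t. {#sqrt t#}) = replicate_mset (dim (eigenspace ?S t)) (sqrt t)"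
      using fin b(5) by simp
  qed
  finally show thesis using that finB card on orthM by blast
qed

section \<open>Coordinates in an orthonormal basis\<close>

definition orthonormal_family :: "(nat \<Rightarrow> real^'c) \<Rightarrow> bool"
  where "orthonormal_family v \<longleftrightarrow>
    (\<forall>i\<in>{1..CARD('c)}. \<forall>j\<in>{1..CARD('c)}. v i \<bullet> v j = (if i = j then 1 else 0))"

text \<open>\<open>CARD('c)\<close> orthonormal vectors are independent and therefore span; the
  residual \<open>y\<close> is orthogonal to all of them, hence to itself.\<close>

lemma orthonormal_family_expansion:
  fixes v :: "nat \<Rightarrow> real^'c"
  assumes "orthonormal_family v"
  shows "x = (\<Sum>k=1..CARD('c). (v k \<bullet> x) *\<^sub>R v k)"
proof -
  let ?I = "{1..CARD('c)}"
  have on: "v i \<bullet> v j = (if i = j then 1 else 0)" if "i \<in> ?I" "j \<in> ?I" for i j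
    using assms that by (auto simp: orthonormal_family_def)
  have inj: "inj_on v ?I"
    by (rule inj_onI) (metis on zero_neq_one)
  have "pairwise orthogonal (v ` ?I)" "0 \<notin> v ` ?I"
    using on by (auto simp: pairwise_def orthogonal_def)
      (metis (no_types, lifting) atLeastAtMost_iff inner_zero_left One_nat_def zero_neq_one)
  then have "independent (v ` ?I)" by (rule pairwise_orthogonal_independent)
  moreover have "card (v ` ?I) = CARD('c)" using inj by (simp add: card_image)
  ultimately have sp: "span (v ` ?I) = UNIV"
    by (metis card_eq_dim dim_UNIV independent_imp_finite order_refl subset_UNIV top.extremum_uniqueI DIM_cart DIM_real mult.right_neutral)
  define y where "y = x - (\<Sum>k\<in>?I. (v k \<bullet> x) *\<^sub>R v k)"
  have "v j \<bullet> y = 0" if "j \<in> ?I" for j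
    using that by (simp add: y_def inner_diff_right inner_sum_right on if_distrib cong: if_cong)
  then have "orthogonal y u" if "u \<in> span (v ` ?I)" for u
    using that by (intro orthogonal_to_span[of u]) (auto simp: orthogonal_def inner_commute)
  then have "y \<bullet> y = 0" using sp by (auto simp: orthogonal_def)
  then have "y = 0" by simp
  then show ?thesis by (simp add: y_def)
qed

lemma orthonormal_family_inner:
  fixes v :: "nat \<Rightarrow> real^'c"
  assumes "orthonormal_family v"
  shows "x \<bullet> y = (\<Sum>k=1..CARD('c). (v k \<bullet> x) * (v k \<bullet> y))"
  by (subst orthonormal_family_expansion[OF assms, of x]) (simp add: inner_sum_left)

text \<open>Parseval's identity in each row. It allows Frobenius inner products to be computed in
  whichever basis of right singular vectors is convenient.\<close>

lemma matrix_inner_orthonormal_family: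
  fixes A B :: "real^'c^'r"
  assumes "orthonormal_family v"
  shows "A \<bullet> B = (\<Sum>k=1..CARD('c). (A *v v k) \<bullet> (B *v v k))"
proof -
  have "A \<bullet> B = (\<Sum>i\<in>UNIV. \<Sum>k=1..CARD('c). (v k \<bullet> A $ i) * (v k \<bullet> B $ i))"
    unfolding inner_vec_def[of A]
    by (intro sum.cong refl) (rule orthonormal_family_inner[OF assms])
  also have "\<dots> = (\<Sum>k=1..CARD('c). \<Sum>i\<in>UNIV. (v k \<bullet> A $ i) * (v k \<bullet> B $ i))"
    by (rule sum.swap)
  also have "\<dots> = (\<Sum>k=1..CARD('c). (A *v v k) \<bullet> (B *v v k))"
    by (simp add: inner_vec_def[of "_ *v _"] matrix_vector_mul_component inner_commute)
  finally show ?thesis .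
qed

lemma matrix_eq_orthonormal_family:
  fixes A B :: "real^'c^'r"
  assumes v: "orthonormal_family v" and eq: "\<And>k. k \<in> {1..CARD('c)} \<Longrightarrow> A *v v k = B *v v k"
  shows "A = B"
proof -
  have "(A - B) \<bullet> (A - B) = 0"
    unfolding matrix_inner_orthonormal_family[OF v]
    using eq by (simp add: matrix_vector_mult_diff_rdistrib)
  then show ?thesis by simp
qed

section \<open>Singular value decomposition\<close>

text \<open>A basis of right singular vectors, characterized by the orthogonality of the images and
  without an order. The same family then serves a matrix and its polar factor.\<close>

definition singular_family :: "real^'c^'r \<Rightarrow> (nat \<Rightarrow> real^'c) \<Rightarrow> bool"
  where "singular_family M v \<longleftrightarrow> orthonormal_family v \<and>
    (\<forall>i\<in>{1..CARD('c)}. \<forall>j\<in>{1..CARD('c)}. i \<noteq> j \<longrightarrow> (M *v v i) \<bullet> (M *v v j) = 0)"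

lemma singular_family_orthonormal: "singular_family M v \<Longrightarrow> orthonormal_family v"
  by (simp add: singular_family_def)

lemma singular_family_orthogonal:
  fixes M :: "real^'c^'r"
  shows "singular_family M v \<Longrightarrow> i \<in> {1..CARD('c)} \<Longrightarrow> j \<in> {1..CARD('c)} \<Longrightarrow> i \<noteq> j \<Longrightarrow>
    (M *v v i) \<bullet> (M *v v j) = 0"
  by (simp add: singular_family_def)

lemma matrix_vector_orthonormal_family:
  fixes M :: "real^'c^'r"
  assumes "orthonormal_family v"
  shows "M *v x = (\<Sum>k=1..CARD('c). (v k \<bullet> x) *\<^sub>R (M *v v k))"
  by (subst orthonormal_family_expansion[OF assms, of x])
    (simp add: linear_sum[OF matrix_vector_mul_linear] matrix_vector_mult_scaleR)

text \<open>The nonzero images are orthogonal, hence independent, and they span the range of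
  \<open>M\<close>.\<close>

lemma rank_eq_card_nonzero_images:
  fixes M :: "real^'c^'r"
  assumes "singular_family M v"
  shows "rank M = card {k \<in> {1..CARD('c)}. M *v v k \<noteq> 0}"
proof -
  note v = singular_family_orthonormal[OF assms] and orth = singular_family_orthogonal[OF assms]
  define K where "K = {k \<in> {1..CARD('c)}. M *v v k \<noteq> 0}"
  define C where "C = (\<lambda>k. M *v v k) ` K"
  have inj: "inj_on (\<lambda>k. M *v v k) K"
  proof (rule inj_onI, rule ccontr)
    fix i j assume "i \<in> K" "j \<in> K" "M *v v i = M *v v j" "i \<noteq> j"
    then show False using orth[of i j] by (auto simp: K_def)
  qed
  have "pairwise orthogonal C"
    using orth by (auto simp: C_def K_def pairwise_def orthogonal_def)
  moreover have "0 \<notin> C" by (auto simp: C_def K_def)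
  ultimately have ind: "independent C" by (rule pairwise_orthogonal_independent)
  have "M *v x \<in> span C" for x
  proof -
    have "M *v x = (\<Sum>k=1..CARD('c). (v k \<bullet> x) *\<^sub>R (M *v v k))"
      by (rule matrix_vector_orthonormal_family[OF v])
    also have "\<dots> \<in> span C"
    proof (intro span_sum span_scale)
      fix k assume "k \<in> {1..CARD('c)}"
      then show "M *v v k \<in> span C"
        by (cases "M *v v k = 0") (auto simp: C_def K_def span_zero intro: span_base)
    qed
    finally show ?thesis .
  qed
  then have "range (\<lambda>x. M *v x) \<subseteq> span C" by auto
  moreover have "C \<subseteq> range (\<lambda>x. M *v x)" by (auto simp: C_def)
  ultimately have "dim (range (\<lambda>x. M *v x)) = card C"
    using ind by (metis dim_eq_card dim_span dim_subset dual_order.antisym span_mono span_span dim_eq_card_independent)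
  then show ?thesis
    using inj by (simp add: rank_dim_range C_def K_def card_image)
qed

text \<open>The eigenvector basis of the Gram matrix is sorted by decreasing length of the image,
  which matches its numbering with that of \<open>singular_value\<close>.\<close>

lemma right_singular_basis:
  fixes M :: "real^'c^'r"
  obtains v where "singular_family M v"
    and "\<And>i j. 1 \<le> i \<Longrightarrow> i \<le> j \<Longrightarrow> j \<le> CARD('c) \<Longrightarrow> norm (M *v v j) \<le> norm (M *v v i)"
    and "\<And>k. k \<in> {1..CARD('c)} \<Longrightarrow> norm (M *v v k) = singular_value M k"
proof -
  obtain B :: "(real^'c) set" where B: "finite B" "card B = CARD('c)"
      "\<And>x y. x \<in> B \<Longrightarrow> y \<in> B \<Longrightarrow> x \<bullet> y = (if x = y then 1 else 0)"
      "\<And>x y. x \<in> B \<Longrightarrow> y \<in> B \<Longrightarrow> x \<noteq> y \<Longrightarrow> (M *v x) \<bullet> (M *v y) = 0"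
      "image_mset (\<lambda>x. norm (M *v x)) (mset_set B) = singular_value_mset M"
    using gram_eigenvector_basis by metis
  obtain xs where xs: "set xs = B" "distinct xs"
    using finite_distinct_list[OF B(1)] by blast
  define f where "f x = norm (M *v x)" for x
  define ys where "ys = rev (sort_key f xs)"
  define v where "v k = ys ! (k - 1)" for k
  have ys: "set ys = B" "distinct ys" "length ys = CARD('c)"
    using xs B(2) distinct_card[OF xs(2)] by (auto simp: ys_def)
  have vB: "v k \<in> B" if "k \<in> {1..CARD('c)}" for k
    using that ys by (auto simp: v_def intro!: nth_mem)
  have vinj: "v i \<noteq> v j" if "i \<in> {1..CARD('c)}" "j \<in> {1..CARD('c)}" "i \<noteq> j" for i j
    using that ys by (auto simp: v_def nth_eq_iff_index_eq)
  have mset: "singular_value_mset M = mset (map f xs)"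
    using B(5) xs mset_set_set[OF xs(2)] by (simp add: f_def[abs_def])
  have "sort (map f xs) = map f (sort_key f xs)"
    by (rule properties_for_sort) simp_all
  then have list: "rev (sorted_list_of_multiset (singular_value_mset M)) = map f ys"
    unfolding mset sorted_list_of_multiset_mset by (simp add: ys_def rev_map)
  have on: "orthonormal_family v"
    using B(3) vB vinj by (auto simp: orthonormal_family_def)
  have orth: "(M *v v i) \<bullet> (M *v v j) = 0"
    if "i \<in> {1..CARD('c)}" "j \<in> {1..CARD('c)}" "i \<noteq> j" for i j
    using B(4) vB vinj that by blast
  have sf: "singular_family M v" using on orth by (simp add: singular_family_def)
  have dec: "norm (M *v v j) \<le> norm (M *v v i)" if "1 \<le> i" "i \<le> j" "j \<le> CARD('c)" for i j
  proof -
    have "sorted (rev (map f ys))" by (simp add: ys_def rev_map[symmetric])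
    then have "map f ys ! (j - 1) \<le> map f ys ! (i - 1)"
      using that ys(3) by (intro sorted_rev_nth_mono) auto
    then show ?thesis using that ys(3) by (simp add: f_def v_def)
  qed
  have "norm (M *v v k) = singular_value M k" if k: "k \<in> {1..CARD('c)}" for k
  proof (cases "k \<le> CARD('r)")
    case True
    then show ?thesis using k ys(3) by (auto simp: singular_value_def list f_def v_def)
  next
    case False
    \<comment> \<open>Beyond the number of rows \<open>singular_value\<close> is 0 by definition, so
      the image has to vanish. A nonzero image at \<open>k\<close> would make the first
      \<open>k\<close> images nonzero and the rank at least \<open>k\<close>, more than
      \<open>CARD('r)\<close>.\<close>
    have "M *v v k = 0"
    proof (rule ccontr)
      assume nz: "M *v v k \<noteq> 0"
      have "{1..k} \<subseteq> {k \<in> {1..CARD('c)}. M *v v k \<noteq> 0}"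
      proof
        fix i assume "i \<in> {1..k}"
        then show "i \<in> {k \<in> {1..CARD('c)}. M *v v k \<noteq> 0}" using dec[of i k] nz k by auto
      qed
      then have "card {1..k} \<le> rank M"
        unfolding rank_eq_card_nonzero_images[OF sf] by (intro card_mono) auto
      then show False using rank_bound[of M] False by simp
    qed
    then show ?thesis using False by (simp add: singular_value_def)
  qed
  then show thesis using that sf dec by blast
qed

section \<open>Order and extremal properties of singular values\<close>

lemma singular_value_nonneg:
  fixes M :: "real^'c^'r"
  assumes "1 \<le> k"
  shows "singular_value M k \<ge> 0"
proof (cases "k \<le> CARD('c)")
  case True
  then show ?thesis using assms right_singular_basis[of M] by (metis atLeastAtMost_iff norm_ge_zero)
next
  case False
  then show ?thesis by (simp add: singular_value_def)
qed

lemma singular_value_antimono: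
  fixes M :: "real^'c^'r"
  assumes "1 \<le> i" "i \<le> j"
  shows "singular_value M j \<le> singular_value M i"
proof (cases "j \<le> CARD('c)")
  case True
  then show ?thesis
  proof -
    obtain v where dec: "\<And>i j. 1 \<le> i \<Longrightarrow> i \<le> j \<Longrightarrow> j \<le> CARD('c) \<Longrightarrow> norm (M *v v j) \<le> norm (M *v v i)"
        and sv: "\<And>k. k \<in> {1..CARD('c)} \<Longrightarrow> norm (M *v v k) = singular_value M k"
      using right_singular_basis by metis
    show ?thesis using dec[of i j] sv[of i] sv[of j] assms True by simp
  qed
next
  case False
  then show ?thesis using singular_value_nonneg[of i M] assms by (simp add: singular_value_def)
qed

text \<open>This says that \<open>v k\<close> is an eigenvector of \<open>transpose M ** M\<close>,
  with the squared length of its image as eigenvalue, tested against \<open>x\<close>.\<close>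

lemma singular_family_inner:
  fixes M :: "real^'c^'r"
  assumes "singular_family M v" "k \<in> {1..CARD('c)}"
  shows "(M *v v k) \<bullet> (M *v x) = (norm (M *v v k))\<^sup>2 * (v k \<bullet> x)"
proof -
  have "(M *v v k) \<bullet> (M *v x) = (\<Sum>j=1..CARD('c). (v j \<bullet> x) * ((M *v v k) \<bullet> (M *v v j)))"
    by (subst matrix_vector_orthonormal_family[OF singular_family_orthonormal[OF assms(1)], of M x])
      (simp add: inner_sum_right)
  also have "\<dots> = (\<Sum>j=1..CARD('c). if j = k then (v k \<bullet> x) * (norm (M *v v k))\<^sup>2 else 0)"
    using singular_family_orthogonal[OF assms]
    by (intro sum.cong refl) (auto simp: power2_norm_eq_inner)
  finally show ?thesis using assms(2) by simp
qed

lemma norm_matrix_vector_squared: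
  fixes M :: "real^'c^'r"
  assumes "singular_family M v"
  shows "(norm (M *v x))\<^sup>2 = (\<Sum>k=1..CARD('c). (v k \<bullet> x)\<^sup>2 * (norm (M *v v k))\<^sup>2)"
proof -
  have "(norm (M *v x))\<^sup>2 = (\<Sum>k=1..CARD('c). (v k \<bullet> x) * ((M *v v k) \<bullet> (M *v x)))"
    unfolding power2_norm_eq_inner
    by (subst matrix_vector_orthonormal_family[OF singular_family_orthonormal[OF assms], of M x])
      (simp add: inner_sum_left)
  also have "\<dots> = (\<Sum>k=1..CARD('c). (v k \<bullet> x)\<^sup>2 * (norm (M *v v k))\<^sup>2)"
    by (intro sum.cong refl) (simp add: singular_family_inner[OF assms] power2_eq_square)
  finally show ?thesis .
qed

lemma orthonormal_family_norm:
  fixes v :: "nat \<Rightarrow> real^'c"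
  assumes "orthonormal_family v"
  shows "(norm x)\<^sup>2 = (\<Sum>k=1..CARD('c). (v k \<bullet> x)\<^sup>2)"
  unfolding power2_norm_eq_inner by (subst orthonormal_family_inner[OF assms]) (simp add: power2_eq_square)

lemma norm_mult_le_singular_value_1:
  fixes M :: "real^'c^'r"
  shows "norm (M *v x) \<le> singular_value M 1 * norm x"
proof -
  obtain v where v: "singular_family M v"
      and sv: "\<And>k. k \<in> {1..CARD('c)} \<Longrightarrow> norm (M *v v k) = singular_value M k"
    using right_singular_basis by metis
  note on = singular_family_orthonormal[OF v]
  have "(norm (M *v x))\<^sup>2 \<le> (\<Sum>k=1..CARD('c). (v k \<bullet> x)\<^sup>2 * (singular_value M 1)\<^sup>2)"
    unfolding norm_matrix_vector_squared[OF v, of x]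
    using sv singular_value_antimono[of 1 _ M] singular_value_nonneg[of _ M]
    by (intro sum_mono mult_left_mono) (auto intro!: power_mono)
  also have "\<dots> = (singular_value M 1 * norm x)\<^sup>2"
    by (simp add: orthonormal_family_norm[OF on] power_mult_distrib sum_distrib_left mult.commute)
  finally show ?thesis
    using singular_value_nonneg[of 1 M] by (simp add: power2_le_iff_abs_le)
qed

text \<open>A vector orthogonal to the kernel has nonzero coordinates only where
  \<open>M *v v k\<close> is nonzero. Such indices are at most \<open>rank M\<close> by the
  ordering, so the lengths of these images are at least the singular value of index
  \<open>rank M\<close>.\<close>

lemma singular_value_rank_le:
  fixes M :: "real^'c^'r"
  assumes ker: "\<And>y. M *v y = 0 \<Longrightarrow> y \<bullet> x = 0"
  shows "singular_value M (rank M) * norm x \<le> norm (M *v x)"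
proof -
  obtain v where v: "singular_family M v"
      and dec: "\<And>i j. 1 \<le> i \<Longrightarrow> i \<le> j \<Longrightarrow> j \<le> CARD('c) \<Longrightarrow> norm (M *v v j) \<le> norm (M *v v i)"
      and sv: "\<And>k. k \<in> {1..CARD('c)} \<Longrightarrow> norm (M *v v k) = singular_value M k"
    using right_singular_basis by metis
  note on = singular_family_orthonormal[OF v]
  let ?s = "singular_value M (rank M)"
  have le: "0 \<le> ?s \<and> ?s \<le> norm (M *v v k)" if k: "k \<in> {1..CARD('c)}" "M *v v k \<noteq> 0" for k
  proof -
    have "{1..k} \<subseteq> {k \<in> {1..CARD('c)}. M *v v k \<noteq> 0}"
    proof
      fix i assume "i \<in> {1..k}"
      then show "i \<in> {k \<in> {1..CARD('c)}. M *v v k \<noteq> 0}" using dec[of i k] k by auto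
    qed
    then have "card {1..k} \<le> rank M"
      unfolding rank_eq_card_nonzero_images[OF v] by (intro card_mono) auto
    then show ?thesis
      using k sv singular_value_antimono[of k "rank M" M] singular_value_nonneg[of "rank M" M] by auto
  qed
  have "(?s * norm x)\<^sup>2 = (\<Sum>k=1..CARD('c). (v k \<bullet> x)\<^sup>2 * ?s\<^sup>2)"
    by (simp add: orthonormal_family_norm[OF on] power_mult_distrib sum_distrib_left mult.commute)
  also have "\<dots> \<le> (norm (M *v x))\<^sup>2"
    unfolding norm_matrix_vector_squared[OF v, of x]
  proof (rule sum_mono)
    fix k assume k: "k \<in> {1..CARD('c)}"
    show "(v k \<bullet> x)\<^sup>2 * ?s\<^sup>2 \<le> (v k \<bullet> x)\<^sup>2 * (norm (M *v v k))\<^sup>2"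
    proof (cases "M *v v k = 0")
      case True
      then show ?thesis using ker by simp
    next
      case False
      then show ?thesis using le[OF k] by (intro mult_left_mono power_mono) auto
    qed
  qed
  finally show ?thesis by (rule power2_le_imp_le) simp
qed

section \<open>Nuclear norm and polar decomposition\<close>

definition nuclear_norm :: "real^'c^'r \<Rightarrow> real"
  where "nuclear_norm A = (\<Sum>k = 1..min CARD('r) CARD('c). singular_value A k)"

text \<open>Indices beyond the number of rows contribute \<open>g 0\<close>, so sums of singular
  values may run over a whole basis of right singular vectors.\<close>

lemma sum_singular_values_extend:
  fixes A :: "real^'c^'r"
  assumes "g 0 = (0::real)"
  shows "(\<Sum>k = m..min CARD('r) CARD('c). g (singular_value A k)) = (\<Sum>k = m..CARD('c). g (singular_value A k))"
  by (rule sum.mono_neutral_left) (use assms in \<open>auto simp: singular_value_def\<close>)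

text \<open>\<open>V\<close> is the partial isometry in the polar decomposition of \<open>A\<close>:
  it maps each right singular vector to its normalized image, or to 0 on the kernel.
  \<open>V ** transpose V\<close> and \<open>transpose V ** V\<close> are then the orthogonal
  projections onto the column and row space of \<open>A\<close>, and pairing \<open>A\<close> with
  \<open>V\<close> gives the nuclear norm.\<close>

lemma polar_factor:
  fixes A :: "real^'c^'r"
  obtains V :: "real^'c^'r"
  where "\<And>x. norm (V *v x) \<le> norm x" "V \<bullet> A = nuclear_norm A"
    and "V ** (transpose V ** A) = A" "A ** (transpose V ** V) = A" "V ** (transpose V ** V) = V"
    and "\<And>x. A *v x = 0 \<Longrightarrow> V *v x = 0"
    and "(norm V)\<^sup>2 = real (rank A)"
proof -
  let ?I = "{1..CARD('c)}"
  obtain v where sf: "singular_family A v"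
      and sv: "\<And>k. k \<in> ?I \<Longrightarrow> norm (A *v v k) = singular_value A k"
    using right_singular_basis by metis
  note v = singular_family_orthonormal[OF sf] and orth = singular_family_orthogonal[OF sf]
  \<comment> \<open>\<open>sgn\<close> normalizes nonzero vectors and fixes 0, which covers the
    kernel of \<open>A\<close> as well.\<close>
  define u where "u k = sgn (A *v v k)" for k
  have on: "v i \<bullet> v j = (if i = j then 1 else 0)" if "i \<in> ?I" "j \<in> ?I" for i j
    using v that by (auto simp: orthonormal_family_def)
  have uu: "u i \<bullet> u j = (if i = j \<and> A *v v i \<noteq> 0 then 1 else 0)" if "i \<in> ?I" "j \<in> ?I" for i j
  proof (cases "i = j")
    case True
    have "u i \<bullet> u i = (norm (u i))\<^sup>2" by (simp add: power2_norm_eq_inner)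
    then show ?thesis using True by (simp add: u_def norm_sgn)
  next
    case False
    then show ?thesis using orth[OF that] by (simp add: u_def sgn_div_norm)
  qed
  have uA: "norm (A *v v k) *\<^sub>R u k = A *v v k" for k
    by (cases "A *v v k = 0") (simp_all add: u_def sgn_div_norm)
  define V where "V = matrix (\<lambda>x. \<Sum>k\<in>?I. (v k \<bullet> x) *\<^sub>R u k)"
  have "linear (\<lambda>x. \<Sum>k\<in>?I. (v k \<bullet> x) *\<^sub>R u k)"
    by (intro linear_compose_sum ballI)
      (auto intro!: linearI simp: inner_add_right scaleR_add_left)
  then have V: "V *v x = (\<Sum>k\<in>?I. (v k \<bullet> x) *\<^sub>R u k)" for x
    unfolding V_def by (simp add: matrix_works)
  have Vv: "V *v v k = u k" if "k \<in> ?I" for k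
    using that by (simp add: V on if_distrib[of "\<lambda>c. c *\<^sub>R _"] cong: if_cong)
  have VT: "transpose V *v u k = (if A *v v k = 0 then 0 else v k)" if k: "k \<in> ?I" for k
  proof -
    \<comment> \<open>The vector is identified by its coordinates in the basis \<open>v\<close>,
      which are the inner products of the \<open>u j\<close> with \<open>u k\<close>.\<close>
    have "v j \<bullet> (transpose V *v u k) = v j \<bullet> (if A *v v k = 0 then 0 else v k)" if "j \<in> ?I" for j
    proof -
      have "v j \<bullet> (transpose V *v u k) = u j \<bullet> u k"
        using Vv[OF that] by (metis dot_lmul_matrix inner_commute vector_transpose_matrix transpose_transpose)
      then show ?thesis using uu[OF that k] on[OF that k] by auto
    qed
    then show ?thesis
      by (subst orthonormal_family_expansion[OF v, of "transpose V *v u k"],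
          subst (2) orthonormal_family_expansion[OF v])
        (intro sum.cong, auto)
  qed
  have VV: "(transpose V ** V) *v v k = (if A *v v k = 0 then 0 else v k)" if "k \<in> ?I" for k
    using VT[OF that] Vv[OF that] by (metis matrix_vector_mul_assoc)
  have orthV: "(V *v v i) \<bullet> (V *v v j) = 0" if "i \<in> ?I" "j \<in> ?I" "i \<noteq> j" for i j
    using uu that by (simp add: Vv)
  have sfV: "singular_family V v" using v orthV by (simp add: singular_family_def)
  have "norm (V *v x) \<le> norm x" for x
  proof -
    have "(norm (V *v x))\<^sup>2 \<le> (\<Sum>k\<in>?I. (v k \<bullet> x)\<^sup>2 * 1)"
      unfolding norm_matrix_vector_squared[OF sfV, of x]
      by (intro sum_mono mult_left_mono) (auto simp: Vv u_def norm_sgn)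
    then have "(norm (V *v x))\<^sup>2 \<le> (norm x)\<^sup>2"
      unfolding orthonormal_family_norm[OF v] by simp
    then show ?thesis by (rule power2_le_imp_le) simp
  qed
  moreover have "V \<bullet> A = nuclear_norm A"
  proof -
    have "V \<bullet> A = (\<Sum>k\<in>?I. norm (A *v v k))"
      unfolding matrix_inner_orthonormal_family[OF v]
    proof (intro sum.cong refl)
      fix k assume "k \<in> ?I"
      then show "(V *v v k) \<bullet> (A *v v k) = norm (A *v v k)"
        by (cases "A *v v k = 0")
          (simp_all add: Vv u_def sgn_div_norm power2_norm_eq_inner[symmetric] power2_eq_square)
    qed
    also have "\<dots> = (\<Sum>k\<in>?I. singular_value A k)" by (simp add: sv)
    finally show ?thesis
      unfolding nuclear_norm_def using sum_singular_values_extend[of "\<lambda>x. x" A 1] by simp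
  qed
  moreover have "V ** (transpose V ** A) = A"
  proof (rule matrix_eq_orthonormal_family[OF v])
    fix k assume k: "k \<in> ?I"
    have "V *v (transpose V *v (norm (A *v v k) *\<^sub>R u k)) = norm (A *v v k) *\<^sub>R u k"
      using VT[OF k] Vv[OF k] by (simp add: matrix_vector_mult_scaleR)
    then show "(V ** (transpose V ** A)) *v v k = A *v v k"
      by (simp add: uA matrix_vector_mul_assoc[symmetric])
  qed
  moreover have "A ** (transpose V ** V) = A"
    by (rule matrix_eq_orthonormal_family[OF v], subst matrix_vector_mul_assoc[symmetric], subst VV) auto
  moreover have "V ** (transpose V ** V) = V"
    by (rule matrix_eq_orthonormal_family[OF v], subst matrix_vector_mul_assoc[symmetric], subst VV)
      (auto simp: Vv u_def)
  moreover have "V *v x = 0" if "A *v x = 0" for x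
    unfolding V
  proof (rule sum.neutral, rule ballI)
    fix k assume "k \<in> ?I"
    then have "(norm (A *v v k))\<^sup>2 * (v k \<bullet> x) = 0"
      using singular_family_inner[OF sf, of k x] that by simp
    then show "(v k \<bullet> x) *\<^sub>R u k = 0" by (auto simp: u_def)
  qed
  moreover have "(norm V)\<^sup>2 = real (rank A)"
  proof -
    have "(norm V)\<^sup>2 = (\<Sum>k\<in>?I. if A *v v k \<noteq> 0 then 1 else 0)"
      unfolding power2_norm_eq_inner matrix_inner_orthonormal_family[OF v]
      using uu by (intro sum.cong) (auto simp: Vv)
    then show ?thesis
      unfolding rank_eq_card_nonzero_images[OF sf]
      by (simp add: sum.If_cases Int_def)
  qed
  ultimately show thesis by (rule that)
qed

section \<open>Nuclear norm\<close>

lemma matrix_diff_ldistrib: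
  fixes A :: "real^'m^'r" and B C :: "real^'c^'m"
  shows "A ** (B - C) = A ** B - A ** C"
  by (simp add: matrix_matrix_mult_def vec_eq_iff sum_subtractf algebra_simps)

lemma matrix_diff_rdistrib:
  fixes A B :: "real^'m^'r" and C :: "real^'c^'m"
  shows "(A - B) ** C = A ** C - B ** C"
  by (simp add: matrix_matrix_mult_def vec_eq_iff sum_subtractf algebra_simps)

lemma transpose_diff:
  fixes A B :: "real^'c^'r"
  shows "transpose (A - B) = transpose A - transpose B"
  by (simp add: transpose_def vec_eq_iff)

lemma inner_matrix_eq_trace:
  fixes A B :: "real^'c^'r"
  shows "A \<bullet> B = trace (transpose A ** B)"
proof -
  have "A \<bullet> B = (\<Sum>i\<in>UNIV. \<Sum>j\<in>UNIV. A $ i $ j * B $ i $ j)"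
    by (simp add: inner_vec_def)
  also have "\<dots> = (\<Sum>j\<in>UNIV. \<Sum>i\<in>UNIV. A $ i $ j * B $ i $ j)"
    by (rule sum.swap)
  also have "\<dots> = trace (transpose A ** B)"
    by (simp add: trace_def matrix_matrix_mult_def transpose_def)
  finally show ?thesis .
qed

lemma inner_matrix_mult_left:
  fixes A :: "real^'m^'r" and B :: "real^'c^'m"
  shows "(A ** B) \<bullet> C = B \<bullet> (transpose A ** C)"
  by (simp add: inner_matrix_eq_trace matrix_transpose_mul matrix_mul_assoc)

lemma inner_matrix_mult_right:
  fixes A :: "real^'m^'r" and B :: "real^'c^'m"
  shows "(A ** B) \<bullet> C = A \<bullet> (C ** transpose B)"
  unfolding inner_matrix_eq_trace matrix_transpose_mul
  by (subst matrix_mul_assoc[symmetric], subst trace_mul_sym) (simp add: matrix_mul_assoc)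

lemma norm_transpose:
  fixes A :: "real^'c^'r"
  shows "norm (transpose A) = norm A"
  unfolding norm_eq_sqrt_inner inner_matrix_eq_trace transpose_transpose
  by (subst trace_mul_sym) (rule refl)

lemma inner_transpose_vector:
  fixes M :: "real^'c^'r"
  shows "x \<bullet> (transpose M *v y) = (M *v x) \<bullet> y"
  by (metis dot_lmul_matrix inner_commute vector_transpose_matrix)

text \<open>Test \<open>M\<close> on \<open>z = transpose M *v y\<close>: the squared norm of
  \<open>z\<close> is \<open>(M *v z) \<bullet> y\<close>, at most
  \<open>c * norm z * norm y\<close>; then cancel \<open>norm z\<close>.\<close>

lemma norm_transpose_mult_le:
  fixes M :: "real^'c^'r"
  assumes "\<And>x. norm (M *v x) \<le> c * norm x"
  shows "norm (transpose M *v y) \<le> c * norm y"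
proof (cases "transpose M *v y = 0")
  case True
  \<comment> \<open>A single unit vector shows that \<open>c\<close> is nonnegative.\<close>
  have "0 \<le> c * norm (axis undefined 1 :: real^'c)"
    using assms norm_ge_zero order_trans by blast
  then show ?thesis using True by simp
next
  case False
  let ?z = "transpose M *v y"
  have "norm ?z * norm ?z = (M *v ?z) \<bullet> y"
    by (simp only: inner_transpose_vector[symmetric] power2_norm_eq_inner[symmetric] power2_eq_square)
  also have "\<dots> \<le> norm (M *v ?z) * norm y" by (rule norm_cauchy_schwarz)
  also have "\<dots> \<le> (c * norm ?z) * norm y"
    by (intro mult_right_mono assms) simp
  finally have "norm ?z * norm ?z \<le> norm ?z * (c * norm y)" by (simp add: mult_ac)
  then show ?thesis using False by (simp add: mult_le_cancel_left)
qed

text \<open>The squared Frobenius norm is the sum of the squared lengths of the images of an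
  orthonormal basis, so a comparison on the range of \<open>B\<close> suffices.\<close>

lemma norm_matrix_mult_mono:
  fixes M :: "real^'m^'r" and N :: "real^'m^'q" and B :: "real^'c^'m"
  assumes "\<And>x. norm (M *v (B *v x)) \<le> norm (N *v (B *v x))"
  shows "norm (M ** B) \<le> norm (N ** B)"
proof -
  obtain v where "singular_family B v"
    using right_singular_basis by metis
  then have v: "orthonormal_family v" by (rule singular_family_orthonormal)
  have "(norm (M ** B))\<^sup>2 \<le> (norm (N ** B))\<^sup>2"
    unfolding power2_norm_eq_inner[of "_ ** _"] matrix_inner_orthonormal_family[OF v]
    by (intro sum_mono)
      (simp add: power2_norm_eq_inner[symmetric] matrix_vector_mul_assoc[symmetric] assms)
  then show ?thesis by (rule power2_le_imp_le) simp
qed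

lemma norm_matrix_mult_le:
  fixes M :: "real^'m^'r" and B :: "real^'c^'m"
  assumes "\<And>x. norm (M *v x) \<le> c * norm x"
  shows "norm (M ** B) \<le> c * norm B"
proof -
  have "0 \<le> c * norm (axis undefined 1 :: real^'m)"
    using assms norm_ge_zero order_trans by blast
  then have c: "0 \<le> c" by simp
  have cm: "(c *\<^sub>R mat 1 :: real^'m^'m) *v x = c *\<^sub>R x" for x
    by (simp add: scaleR_matrix_vector_assoc[symmetric])
  have "norm (M ** B) \<le> norm ((c *\<^sub>R mat 1 :: real^'m^'m) ** B)"
    by (rule norm_matrix_mult_mono) (use assms c in \<open>simp add: cm\<close>)
  also have "(c *\<^sub>R mat 1 :: real^'m^'m) ** B = c *\<^sub>R B"
    by (simp add: scalar_matrix_assoc[symmetric])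
  finally show ?thesis using c by simp
qed

text \<open>One half of the duality between operator norm and nuclear norm: in a basis of right
  singular vectors of \<open>A\<close> each term is bounded by Cauchy-Schwarz. The polar factor of
  \<open>A\<close> attains equality for \<open>c = 1\<close>.\<close>

lemma inner_le_nuclear_norm:
  fixes A V :: "real^'c^'r"
  assumes "\<And>x. norm (V *v x) \<le> c * norm x"
  shows "V \<bullet> A \<le> c * nuclear_norm A"
proof -
  obtain v where v: "singular_family A v"
      and sv: "\<And>k. k \<in> {1..CARD('c)} \<Longrightarrow> norm (A *v v k) = singular_value A k"
    using right_singular_basis by metis
  note on = singular_family_orthonormal[OF v]
  have "V \<bullet> A = (\<Sum>k=1..CARD('c). (V *v v k) \<bullet> (A *v v k))"
    by (rule matrix_inner_orthonormal_family[OF on])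
  also have "\<dots> \<le> (\<Sum>k=1..CARD('c). c * norm (A *v v k))"
  proof (rule sum_mono)
    fix k assume k: "k \<in> {1..CARD('c)}"
    then have "norm (v k) = 1" using on by (auto simp: orthonormal_family_def norm_eq_1)
    then have "norm (V *v v k) \<le> c" using assms[of "v k"] by simp
    then show "(V *v v k) \<bullet> (A *v v k) \<le> c * norm (A *v v k)"
      by (meson mult_right_mono norm_cauchy_schwarz norm_ge_zero order_trans)
  qed
  also have "\<dots> = c * (\<Sum>k=1..CARD('c). singular_value A k)"
    by (simp add: sv sum_distrib_left)
  finally show ?thesis
    unfolding nuclear_norm_def using sum_singular_values_extend[of "\<lambda>x. x" A 1] by simp
qed

text \<open>By duality: \<open>P\<close> moves from \<open>A\<close> to the polar factor
  \<open>V\<close> of \<open>P ** A\<close>, and \<open>transpose P ** V\<close> is again a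
  contraction. Hence projecting the estimator does not raise the penalty.\<close>

lemma nuclear_norm_mult_le:
  fixes A :: "real^'c^'m" and P :: "real^'m^'r"
  assumes "\<And>x. norm (P *v x) \<le> norm x"
  shows "nuclear_norm (P ** A) \<le> nuclear_norm A"
proof -
  obtain V :: "real^'c^'r" where V: "\<And>x. norm (V *v x) \<le> norm x" "V \<bullet> (P ** A) = nuclear_norm (P ** A)"
    using polar_factor[of "P ** A"] by metis
  have PT: "norm (transpose P *v x) \<le> 1 * norm x" for x
    by (rule norm_transpose_mult_le) (simp add: assms)
  have "norm ((transpose P ** V) *v x) \<le> 1 * norm x" for x
    using PT[of "V *v x"] V(1)[of x] by (simp add: matrix_vector_mul_assoc[symmetric] del: vector_transpose_matrix)
  then have "(transpose P ** V) \<bullet> A \<le> 1 * nuclear_norm A" by (rule inner_le_nuclear_norm)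
  then show ?thesis
    using V(2) by (simp add: inner_matrix_mult_left)
qed

text \<open>The nuclear norm is a maximum of linear functionals over contractions; the functional
  attaining it at the convex combination is bounded by the nuclear norm at both end points.\<close>

lemma nuclear_norm_convex:
  fixes A B :: "real^'c^'r"
  assumes "0 \<le> t" "t \<le> 1"
  shows "nuclear_norm ((1 - t) *\<^sub>R A + t *\<^sub>R B) \<le> (1 - t) * nuclear_norm A + t * nuclear_norm B"
proof -
  let ?C = "(1 - t) *\<^sub>R A + t *\<^sub>R B"
  obtain V :: "real^'c^'r" where V: "\<And>x. norm (V *v x) \<le> 1 * norm x" "V \<bullet> ?C = nuclear_norm ?C"
    using polar_factor[of ?C] by (metis mult_1)
  have "V \<bullet> ?C = (1 - t) * (V \<bullet> A) + t * (V \<bullet> B)"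
    by (simp add: inner_add_right)
  also have "\<dots> \<le> (1 - t) * nuclear_norm A + t * nuclear_norm B"
    using inner_le_nuclear_norm[OF V(1), of A] inner_le_nuclear_norm[OF V(1), of B] assms
    by (intro add_mono mult_left_mono) auto
  finally show ?thesis using V(2) by simp
qed

lemma symmetric_idempotent_pythagoras:
  fixes P :: "real^'m^'m"
  assumes P: "transpose P = P" "P ** P = P"
  shows "(P *v x) \<bullet> ((mat 1 - P) *v y) = 0"
    and "(norm x)\<^sup>2 = (norm (P *v x))\<^sup>2 + (norm ((mat 1 - P) *v x))\<^sup>2"
    and "norm (P *v x) \<le> norm x" and "norm ((mat 1 - P) *v x) \<le> norm x"
proof -
  have orth: "(P *v x) \<bullet> ((mat 1 - P) *v y) = 0" for x y
  proof -
    have "(P *v x) \<bullet> ((mat 1 - P) *v y) = x \<bullet> (P *v ((mat 1 - P) *v y))"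
      using inner_transpose_vector[of x P] P(1) by simp
    also have "P *v ((mat 1 - P) *v y) = 0"
      using P(2) by (simp add: matrix_vector_mult_diff_rdistrib matrix_vector_mult_diff_distrib matrix_vector_mul_assoc)
    finally show ?thesis by simp
  qed
  then show "(P *v x) \<bullet> ((mat 1 - P) *v y) = 0" .
  have "x = P *v x + (mat 1 - P) *v x" by (simp add: matrix_vector_mult_diff_rdistrib)
  then show pyth: "(norm x)\<^sup>2 = (norm (P *v x))\<^sup>2 + (norm ((mat 1 - P) *v x))\<^sup>2"
    using norm_add_Pythagorean[of "P *v x" "(mat 1 - P) *v x"] orth[of x x]
    by (simp add: orthogonal_def)
  show "norm (P *v x) \<le> norm x" "norm ((mat 1 - P) *v x) \<le> norm x"
    by (rule power2_le_imp_le; use pyth in simp)+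
qed

text \<open>The bound involves the rank of \<open>A\<close> but not that of \<open>D\<close>.
  Because \<open>M\<close> has operator norm at most \<open>lam / 2\<close>, twice its pairing with
  the block of \<open>D\<close> orthogonal to \<open>A\<close> is at most \<open>lam\<close> times
  the nuclear norm of this block, exactly what the subgradient inequality subtracts. What remains is
  linear in \<open>D\<close>, represented by \<open>2 *\<^sub>R K - lam *\<^sub>R V\<close>.\<close>

lemma nuclear_norm_perturbation:
  fixes A D M :: "real^'c^'r"
  assumes M: "\<And>x. norm (M *v x) \<le> lam / 2 * norm x" and lam: "0 \<le> lam"
  shows "lam * (nuclear_norm A - nuclear_norm (A + D)) + 2 * (M \<bullet> D)
    \<le> sqrt (6 * real (rank A)) * lam * norm D"
proof -
  obtain V where V: "\<And>x. norm (V *v x) \<le> norm x" "V \<bullet> A = nuclear_norm A"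
      "V ** (transpose V ** A) = A" "A ** (transpose V ** V) = A" "V ** (transpose V ** V) = V"
      "(norm V)\<^sup>2 = real (rank A)"
    using polar_factor by metis
  \<comment> \<open>\<open>P\<close> and \<open>Q\<close> are the orthogonal projections onto the
    column space and the row space of \<open>A\<close>.\<close>
  define P where "P = V ** transpose V"
  define Q where "Q = transpose V ** V"
  define P' where "P' = mat 1 - P"
  define Q' where "Q' = mat 1 - Q"
  define r where "r = real (rank A)"
  have P: "transpose P = P" "P ** P = P"
    using V(5) by (simp_all add: P_def matrix_transpose_mul matrix_mul_assoc)
  have Q: "transpose Q = Q" "Q ** Q = Q"
    using V(5) by (simp_all add: Q_def matrix_transpose_mul matrix_mul_assoc[symmetric])
  have P': "transpose P' = P'" "P ** P' = 0" and Q': "transpose Q' = Q'"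
    using P Q by (simp_all add: P'_def Q'_def transpose_diff matrix_diff_ldistrib matrix_diff_rdistrib)
  have AQ': "A ** Q' = 0" using V(4) by (simp add: Q_def Q'_def matrix_diff_ldistrib)
  have VQ: "V ** Q = V" "P ** V = V" using V(5) by (simp_all add: Q_def P_def matrix_mul_assoc)
  define G where "G = P' ** (D ** Q')"
  obtain W where W: "\<And>x. norm (W *v x) \<le> norm x" "W \<bullet> G = nuclear_norm G"
    using polar_factor by metis
  have block: "(P' ** (B ** R)) \<bullet> C = B \<bullet> (P' ** (C ** R))" if "transpose R = R" for B C R
    by (subst inner_matrix_mult_left, subst inner_matrix_mult_right) (simp add: P' that matrix_mul_assoc)
  \<comment> \<open>A subgradient of the nuclear norm at A which is also aligned with the block of D
      orthogonal to the row and column spaces of A.\<close>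
  define Z where "Z = V + P' ** (W ** Q')"
  have "norm (Z *v x) \<le> 1 * norm x" for x
  proof -
    \<comment> \<open>\<open>Z\<close> is a contraction because its two summands act on the
      orthogonal components \<open>Q *v x\<close> and \<open>Q' *v x\<close> and take values in the
      orthogonal ranges of \<open>P\<close> and \<open>P'\<close>.\<close>
    have "Z *v x = P *v (V *v x) + P' *v (W *v (Q' *v x))"
      by (simp add: Z_def matrix_vector_mult_add_rdistrib matrix_vector_mul_assoc VQ matrix_mul_assoc)
    then have "(norm (Z *v x))\<^sup>2 = (norm (P *v (V *v x)))\<^sup>2 + (norm (P' *v (W *v (Q' *v x))))\<^sup>2"
      using symmetric_idempotent_pythagoras(1)[OF P]
      by (simp add: norm_add_Pythagorean orthogonal_def P'_def)
    also have "P *v (V *v x) = V *v (Q *v x)" by (simp add: matrix_vector_mul_assoc VQ)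
    also have "(norm (V *v (Q *v x)))\<^sup>2 + (norm (P' *v (W *v (Q' *v x))))\<^sup>2
        \<le> (norm (Q *v x))\<^sup>2 + (norm (Q' *v x))\<^sup>2"
      unfolding P'_def
      by (intro add_mono power_mono V(1) order_trans[OF symmetric_idempotent_pythagoras(4)[OF P] W(1)])
        simp_all
    also have "\<dots> = (norm x)\<^sup>2"
      unfolding Q'_def by (rule symmetric_idempotent_pythagoras(2)[OF Q, symmetric])
    finally show ?thesis using power2_le_imp_le[of "norm (Z *v x)" "norm x"] by simp
  qed
  then have "Z \<bullet> (A + D) \<le> 1 * nuclear_norm (A + D)" by (rule inner_le_nuclear_norm)
  moreover have "Z \<bullet> A = nuclear_norm A"
    by (simp add: Z_def inner_add_left V(2) block[OF Q'] AQ')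
  moreover have "Z \<bullet> D = V \<bullet> D + nuclear_norm G"
    using W(2) by (simp add: Z_def inner_add_left block[OF Q'] G_def)
  ultimately have N: "nuclear_norm A - nuclear_norm (A + D) \<le> - (V \<bullet> D) - nuclear_norm G"
    by (simp add: inner_add_right)
  have MG: "M \<bullet> G \<le> lam / 2 * nuclear_norm G" by (rule inner_le_nuclear_norm[OF M])
  \<comment> \<open>\<open>K\<close> is the part of the noise seen by \<open>D - G\<close>: the
    projections are moved from \<open>D\<close> to \<open>M\<close>.\<close>
  define K where "K = P ** M + P' ** (M ** Q)"
  have "D - G = P ** D + P' ** (D ** Q)"
    by (simp add: G_def P'_def Q'_def matrix_diff_ldistrib matrix_diff_rdistrib)
  then have "M \<bullet> (D - G) = K \<bullet> D"
    by (simp add: K_def inner_add_left inner_add_right block[OF Q(1)] inner_matrix_mult_left[of P] P)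
  then have MD: "M \<bullet> D = M \<bullet> G + K \<bullet> D" by (simp add: inner_diff_right)
  have normV: "norm V = sqrt r" using V(6) by (simp add: r_def real_sqrt_unique)
  have VT: "norm (transpose V *v x) \<le> 1 * norm x" for x
    by (rule norm_transpose_mult_le) (simp add: V(1))
  have MT: "norm (transpose M *v x) \<le> lam / 2 * norm x" for x
    by (rule norm_transpose_mult_le[OF M])
  \<comment> \<open>The projection factors through \<open>V\<close>, whose Frobenius norm is
    \<open>sqrt r\<close>; transposing brings \<open>V\<close> to the side on which the operator
    bound for \<open>M\<close> applies.\<close>
  have PM: "norm (P ** M) \<le> lam / 2 * sqrt r"
  proof -
    have "norm (P ** M) \<le> 1 * norm (transpose V ** M)"
      unfolding P_def matrix_mul_assoc[symmetric] by (rule norm_matrix_mult_le) (simp add: V(1))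
    also have "\<dots> = norm (transpose M ** V)"
      using norm_transpose[of "transpose V ** M"] by (simp add: matrix_transpose_mul)
    also have "\<dots> \<le> lam / 2 * norm V" by (rule norm_matrix_mult_le[OF MT])
    finally show ?thesis by (simp add: normV)
  qed
  have PMQ: "norm (P' ** (M ** Q)) \<le> lam / 2 * sqrt r"
  proof -
    have "norm (P' ** (M ** Q)) \<le> 1 * norm (M ** Q)"
      unfolding P'_def by (rule norm_matrix_mult_le) (simp add: symmetric_idempotent_pythagoras(4)[OF P])
    also have "\<dots> = norm (transpose V ** (V ** transpose M))"
      using norm_transpose[of "M ** Q"] by (simp add: matrix_transpose_mul Q Q_def matrix_mul_assoc)
    also have "\<dots> \<le> 1 * norm (V ** transpose M)" by (rule norm_matrix_mult_le[OF VT])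
    also have "\<dots> = norm (M ** transpose V)"
      using norm_transpose[of "V ** transpose M"] by (simp add: matrix_transpose_mul)
    also have "\<dots> \<le> lam / 2 * norm (transpose V)" by (rule norm_matrix_mult_le[OF M])
    finally show ?thesis by (simp add: normV norm_transpose)
  qed
  \<comment> \<open>Orthogonality of the two parts of \<open>K\<close> combines their bounds with
    the factor \<open>sqrt 2\<close> instead of 2; the latter would give 3, which exceeds
    \<open>sqrt 6\<close>.\<close>
  have "(P ** M) \<bullet> (P' ** (M ** Q)) = 0"
    by (simp add: inner_matrix_mult_left P P' matrix_mul_assoc)
  then have "(norm K)\<^sup>2 = (norm (P ** M))\<^sup>2 + (norm (P' ** (M ** Q)))\<^sup>2"
    by (simp add: K_def norm_add_Pythagorean orthogonal_def)
  also have "\<dots> \<le> (lam / 2 * sqrt r)\<^sup>2 + (lam / 2 * sqrt r)\<^sup>2"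
    using PM PMQ by (intro add_mono power_mono) auto
  also have "\<dots> = (lam / 2 * sqrt r * sqrt 2)\<^sup>2" by (simp add: power_mult_distrib power_divide)
  finally have nK: "norm K \<le> lam / 2 * sqrt r * sqrt 2"
    by (rule power2_le_imp_le) (use lam in \<open>simp add: r_def\<close>)
  have "lam * (nuclear_norm A - nuclear_norm (A + D)) + 2 * (M \<bullet> D)
      \<le> lam * (- (V \<bullet> D) - nuclear_norm G) + 2 * (lam / 2 * nuclear_norm G + K \<bullet> D)"
    using mult_left_mono[OF N lam] MG MD by (intro add_mono) auto
  also have "\<dots> = (2 *\<^sub>R K - lam *\<^sub>R V) \<bullet> D" by (simp add: inner_diff_left algebra_simps)
  also have "\<dots> \<le> norm (2 *\<^sub>R K - lam *\<^sub>R V) * norm D" by (rule norm_cauchy_schwarz)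
  also have "\<dots> \<le> (sqrt (6 * r) * lam) * norm D"
  proof (rule mult_right_mono)
    have "norm (2 *\<^sub>R K - lam *\<^sub>R V) \<le> 2 * norm K + lam * sqrt r"
      using norm_triangle_ineq4[of "2 *\<^sub>R K" "lam *\<^sub>R V"] lam normV by simp
    also have "\<dots> \<le> (1 + sqrt 2) * sqrt r * lam" using nK by (simp add: algebra_simps)
    also have "\<dots> \<le> sqrt 6 * sqrt r * lam"
    proof (intro mult_right_mono)
      \<comment> \<open>The square of \<open>1 + sqrt 2\<close> is \<open>3 + 2 * sqrt 2\<close>, so
        this bound on \<open>sqrt 2\<close> yields exactly 6.\<close>
      have "sqrt 2 \<le> 3 / 2" by (rule real_le_lsqrt) (auto simp: power2_eq_square)
      then have "(1 + sqrt 2)\<^sup>2 \<le> 6" by (simp add: power2_sum)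
      then show "1 + sqrt 2 \<le> sqrt 6" by (rule real_le_rsqrt)
    qed (use lam in \<open>auto simp: r_def\<close>)
    finally show "norm (2 *\<^sub>R K - lam *\<^sub>R V) \<le> sqrt (6 * r) * lam" by (simp add: real_sqrt_mult)
  qed simp
  finally show ?thesis by (simp add: r_def)
qed

section \<open>Best low-rank approximation\<close>

text \<open>Bathtub principle: among weights in [0,1] of total at most \<open>r\<close>, the most of
  a nonincreasing sequence is captured by weight 1 on the first \<open>r\<close> terms.\<close>

lemma tail_sum_le_weighted_sum:
  fixes s w :: "nat \<Rightarrow> real"
  assumes s: "\<And>i j. 1 \<le> i \<Longrightarrow> i \<le> j \<Longrightarrow> s j \<le> s i" "\<And>i. 1 \<le> i \<Longrightarrow> 0 \<le> s i"
    and w: "\<And>k. k \<in> {1..n} \<Longrightarrow> 0 \<le> w k" "\<And>k. k \<in> {1..n} \<Longrightarrow> w k \<le> 1" "(\<Sum>k=1..n. w k) \<le> real r"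
  shows "(\<Sum>k=r+1..n. s k) \<le> (\<Sum>k=1..n. s k * (1 - w k))"
proof (cases "r \<le> n")
  case False
  then show ?thesis using s w by (auto intro!: sum_nonneg)
next
  case True
  \<comment> \<open>With this threshold, \<open>s k - c\<close> has the sign of the difference
    between the extremal weight and \<open>w k\<close>, so the comparison holds term by
    term.\<close>
  define c where "c = s (r + 1)"
  have tail: "(\<Sum>k=r+1..n. f k) = (\<Sum>k=1..n. if r < k then f k else 0)" for f :: "nat \<Rightarrow> real"
    by (simp add: sum.If_cases Int_def) (rule sum.cong, auto)
  have "real n - real r = (\<Sum>k=1..n. if r < k then 1 else 0)"
    using tail[of "\<lambda>_. 1"] True by simp
  then have "c * (real r - (\<Sum>k=1..n. w k)) = c * ((\<Sum>k=1..n. 1) - (\<Sum>k=1..n. w k) - (\<Sum>k=1..n. if r < k then 1 else 0))"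
    by simp
  also have "\<dots> = (\<Sum>k=1..n. c * (1 - w k - (if r < k then 1 else 0)))"
    by (simp only: sum_subtractf[symmetric] sum_distrib_left)
  also have "\<dots> \<le> (\<Sum>k=1..n. s k * (1 - w k) - (if r < k then s k else 0))"
  proof (rule sum_mono)
    fix k assume k: "k \<in> {1..n}"
    show "c * (1 - w k - (if r < k then 1 else 0)) \<le> s k * (1 - w k) - (if r < k then s k else 0)"
    proof (cases "r < k")
      case True
      then have "s k * w k \<le> c * w k"
        unfolding c_def using w(1)[OF k] by (intro mult_right_mono s(1)) auto
      then show ?thesis using True by (simp add: algebra_simps)
    next
      case False
      then have "c * (1 - w k) \<le> s k * (1 - w k)"
        unfolding c_def using w(2)[OF k] k by (intro mult_right_mono s(1)) auto
      then show ?thesis using False by simp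
    qed
  qed
  also have "\<dots> = (\<Sum>k=1..n. s k * (1 - w k)) - (\<Sum>k=r+1..n. s k)"
    by (simp only: sum_subtractf tail)
  finally have "c * (real r - (\<Sum>k=1..n. w k)) \<le> (\<Sum>k=1..n. s k * (1 - w k)) - (\<Sum>k=r+1..n. s k)" .
  moreover have "0 \<le> c * (real r - (\<Sum>k=1..n. w k))"
    using w(3) s(2)[of "r + 1"] by (simp add: c_def)
  ultimately show ?thesis by linarith
qed

text \<open>The projection \<open>Q'\<close> away from the row space of \<open>B\<close> kills
  \<open>B\<close>, so the distance from \<open>B\<close> to \<open>C\<close> is at least the norm
  of \<open>C ** Q'\<close>. In right singular vectors of \<open>C\<close> the square of the latter
  is a sum of squared singular values weighted by \<open>1 - w k\<close>, where the
  \<open>w k\<close> sum to \<open>rank B\<close>; the bathtub principle applies.\<close>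

lemma eckart_young_lower_bound:
  fixes B C :: "real^'c^'r"
  assumes "rank B \<le> r"
  shows "(\<Sum>k=r+1..min CARD('r) CARD('c). (singular_value C k)\<^sup>2) \<le> (norm (B - C))\<^sup>2"
proof -
  let ?I = "{1..CARD('c)}"
  obtain V :: "real^'c^'r" where V: "\<And>x. norm (V *v x) \<le> norm x" "B ** (transpose V ** V) = B"
      "V ** (transpose V ** V) = V" "(norm V)\<^sup>2 = real (rank B)"
    using polar_factor[of B] by metis
  define Q where "Q = transpose V ** V"
  define Q' where "Q' = mat 1 - Q"
  have Q: "transpose Q = Q" "Q ** Q = Q"
    using V(3) by (simp_all add: Q_def matrix_transpose_mul matrix_mul_assoc[symmetric])
  have Q': "transpose Q' = Q'" "Q' ** Q' = Q'" "B ** Q' = 0"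
    using Q V(2) by (simp_all add: Q'_def Q_def[symmetric] transpose_diff matrix_diff_ldistrib matrix_diff_rdistrib)
  obtain v where sf: "singular_family C v"
      and sv: "\<And>k. k \<in> ?I \<Longrightarrow> norm (C *v v k) = singular_value C k"
    using right_singular_basis by metis
  note v = singular_family_orthonormal[OF sf]
  define w where "w k = (norm (V *v v k))\<^sup>2" for k
  have w: "0 \<le> w k" "w k \<le> 1" "v k \<bullet> (Q' *v v k) = 1 - w k" if k: "k \<in> ?I" for k
  proof -
    have vk: "v k \<bullet> v k = 1" using v k by (simp add: orthonormal_family_def)
    then have "norm (v k) = 1" by (simp add: norm_eq_1)
    then show "0 \<le> w k" "w k \<le> 1"
      using V(1)[of "v k"] by (simp_all add: w_def power_le_one)
    have "v k \<bullet> (Q *v v k) = w k"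
      unfolding Q_def gram_inner w_def by (simp add: power2_norm_eq_inner)
    then show "v k \<bullet> (Q' *v v k) = 1 - w k"
      by (simp add: Q'_def matrix_vector_mult_diff_rdistrib inner_diff_right vk)
  qed
  have "(\<Sum>k\<in>?I. w k) = (norm V)\<^sup>2"
    unfolding w_def power2_norm_eq_inner by (rule matrix_inner_orthonormal_family[OF v, symmetric])
  then have ws: "(\<Sum>k\<in>?I. w k) \<le> real r" using V(4) assms by simp
  have "(\<Sum>k=r+1..min CARD('r) CARD('c). (singular_value C k)\<^sup>2) = (\<Sum>k=r+1..CARD('c). (singular_value C k)\<^sup>2)"
    by (rule sum_singular_values_extend) simp
  also have "\<dots> \<le> (\<Sum>k\<in>?I. (singular_value C k)\<^sup>2 * (1 - w k))"
    by (rule tail_sum_le_weighted_sum)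
      (use w ws in \<open>auto intro!: power_mono singular_value_antimono singular_value_nonneg\<close>)
  also have "\<dots> = (\<Sum>k\<in>?I. (C *v v k) \<bullet> (C *v (Q' *v v k)))"
    by (intro sum.cong refl) (simp add: singular_family_inner[OF sf] w(3) sv)
  also have "\<dots> = C \<bullet> (C ** Q')"
    by (simp only: matrix_inner_orthonormal_family[OF v] matrix_vector_mul_assoc)
  also have "\<dots> = C \<bullet> ((C ** Q') ** transpose Q')"
    by (simp add: Q' matrix_mul_assoc[symmetric])
  also have "\<dots> = (norm (C ** Q'))\<^sup>2"
    by (simp only: power2_norm_eq_inner inner_matrix_mult_right)
  also have "C ** Q' = - ((B - C) ** Q')"
    by (simp add: matrix_diff_rdistrib Q')
  also have "norm (- ((B - C) ** Q')) = norm (Q' ** transpose (B - C))"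
    using norm_transpose[of "(B - C) ** Q'"] by (simp add: matrix_transpose_mul Q')
  also have "(norm (Q' ** transpose (B - C)))\<^sup>2 \<le> (1 * norm (transpose (B - C)))\<^sup>2"
    unfolding Q'_def
    by (intro power_mono norm_matrix_mult_le) (simp_all add: symmetric_idempotent_pythagoras(4)[OF Q])
  also have "\<dots> = (norm (B - C))\<^sup>2" by (simp add: norm_transpose)
  finally show ?thesis .
qed

text \<open>\<open>Q\<close> is the projection onto the span of the first \<open>r\<close> right
  singular vectors: it keeps these and kills the others.\<close>

lemma truncated_svd:
  fixes C :: "real^'c^'r"
  assumes r: "r \<le> CARD('c)"
  obtains Q :: "real^'c^'c" where "rank Q \<le> r"
    and "(norm (C ** Q - C))\<^sup>2 = (\<Sum>k=r+1..min CARD('r) CARD('c). (singular_value C k)\<^sup>2)"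
proof -
  let ?I = "{1..CARD('c)}"
  obtain v where sf: "singular_family C v"
      and sv: "\<And>k. k \<in> ?I \<Longrightarrow> norm (C *v v k) = singular_value C k"
    using right_singular_basis by metis
  note v = singular_family_orthonormal[OF sf]
  define Q :: "real^'c^'c" where "Q = matrix (\<lambda>x. \<Sum>k=1..r. (v k \<bullet> x) *\<^sub>R v k)"
  have "linear (\<lambda>x. \<Sum>k=1..r. (v k \<bullet> x) *\<^sub>R v k)"
    by (intro linear_compose_sum ballI)
      (auto intro!: linearI simp: inner_add_right scaleR_add_left)
  then have Q: "Q *v x = (\<Sum>k=1..r. (v k \<bullet> x) *\<^sub>R v k)" for x
    unfolding Q_def by (simp add: matrix_works)
  have "Q *v x \<in> span (v ` {1..r})" for x
    unfolding Q by (intro span_sum span_scale span_base) auto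
  then have "dim (range (\<lambda>x. Q *v x)) \<le> card (v ` {1..r})"
    by (intro dim_le_card) auto
  also have "\<dots> \<le> r" using card_image_le[of "{1..r}" v] by simp
  finally have "rank Q \<le> r" by (simp add: rank_dim_range)
  moreover have "(norm (C ** Q - C))\<^sup>2 = (\<Sum>k=r+1..min CARD('r) CARD('c). (singular_value C k)\<^sup>2)"
  proof -
    have Qv: "Q *v v j = (if j \<le> r then v j else 0)" if j: "j \<in> ?I" for j
    proof -
      have "Q *v v j = (\<Sum>k=1..r. if k = j then v j else 0)"
        unfolding Q using v j r by (intro sum.cong) (auto simp: orthonormal_family_def)
      then show ?thesis using j by auto
    qed
    have "(norm (C ** Q - C))\<^sup>2 = (\<Sum>k\<in>?I. if r < k then (singular_value C k)\<^sup>2 else 0)"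
      unfolding power2_norm_eq_inner matrix_inner_orthonormal_family[OF v]
    proof (intro sum.cong refl)
      fix k assume k: "k \<in> ?I"
      then show "((C ** Q - C) *v v k) \<bullet> ((C ** Q - C) *v v k) = (if r < k then (singular_value C k)\<^sup>2 else 0)"
        using sv[OF k] Qv[OF k]
        by (simp add: matrix_vector_mult_diff_rdistrib matrix_vector_mul_assoc[symmetric]
            power2_norm_eq_inner[symmetric])
    qed
    also have "\<dots> = (\<Sum>k=r+1..CARD('c). (singular_value C k)\<^sup>2)"
      by (simp add: sum.If_cases Int_def) (rule sum.cong, auto)
    also have "\<dots> = (\<Sum>k=r+1..min CARD('r) CARD('c). (singular_value C k)\<^sup>2)"
      by (rule sum_singular_values_extend[symmetric]) simp
    finally show ?thesis .
  qed
  ultimately show thesis by (rule that)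
qed

section \<open>The oracle inequality\<close>

lemma nonneg_if_perturbation_nonneg:
  fixes a b :: real
  assumes "\<And>t. 0 < t \<Longrightarrow> t \<le> 1 \<Longrightarrow> 0 \<le> a + t * b"
  shows "0 \<le> a"
proof (rule ccontr)
  assume a: "\<not> 0 \<le> a"
  \<comment> \<open>This \<open>t\<close> makes \<open>t * b\<close> at most \<open>- a / 2\<close>,
    so that \<open>a + t * b\<close> is negative.\<close>
  define t where "t = min 1 (- a / (2 * (\<bar>b\<bar> + 1)))"
  have "0 < - a / (2 * (\<bar>b\<bar> + 1))" using a by (intro divide_pos_pos) auto
  then have t: "0 < t" "t \<le> 1" by (auto simp: t_def)
  have "t * b \<le> t * (\<bar>b\<bar> + 1)" using t by (intro mult_left_mono) auto
  also have "\<dots> \<le> (- a / (2 * (\<bar>b\<bar> + 1))) * (\<bar>b\<bar> + 1)"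
    by (intro mult_right_mono) (auto simp: t_def)
  also have "\<dots> = - a / 2" by (simp add: field_simps)
  finally show False using assms[OF t] a by simp
qed

text \<open>The minimizer is compared with points on the segment to \<open>B\<close>. Convexity
  bounds the change of the penalty linearly in \<open>t\<close>; dividing by \<open>t\<close> and
  letting it tend to 0 removes the quadratic term of the loss.\<close>

lemma penalized_minimizer_variational_inequality:
  fixes X :: "real^'p^'n" and Y :: "real^'t^'n" and A B :: "real^'t^'p"
  assumes min: "\<And>C. (norm (Y - X ** A))\<^sup>2 + lam * nuclear_norm A \<le> (norm (Y - X ** C))\<^sup>2 + lam * nuclear_norm C"
    and lam: "0 \<le> lam"
  shows "0 \<le> 2 * ((Y - X ** A) \<bullet> (X ** (A - B))) + lam * (nuclear_norm B - nuclear_norm A)"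
proof (rule nonneg_if_perturbation_nonneg)
  fix t :: real assume t: "0 < t" "t \<le> 1"
  let ?R = "Y - X ** A" and ?D = "X ** (A - B)"
  let ?C = "(1 - t) *\<^sub>R A + t *\<^sub>R B"
  have "X ** ?C = X ** A - t *\<^sub>R ?D"
  proof -
    have "?C = A - t *\<^sub>R (A - B)" by (simp add: algebra_simps)
    moreover have "X ** (t *\<^sub>R (A - B)) = t *\<^sub>R ?D"
      by (simp add: matrix_scalar_ac scalar_matrix_assoc)
    ultimately show ?thesis by (simp only: matrix_diff_ldistrib)
  qed
  then have "Y - X ** ?C = ?R + t *\<^sub>R ?D" by simp
  then have "(norm (Y - X ** ?C))\<^sup>2 = (norm ?R)\<^sup>2 + t * (2 * (?R \<bullet> ?D)) + t * (t * (norm ?D)\<^sup>2)"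
    by (simp add: power2_norm_eq_inner inner_add_left inner_add_right inner_commute algebra_simps)
  moreover have "lam * nuclear_norm ?C \<le> lam * ((1 - t) * nuclear_norm A + t * nuclear_norm B)"
    using nuclear_norm_convex[of t A B] t lam by (intro mult_left_mono) auto
  ultimately have "0 \<le> t * (2 * (?R \<bullet> ?D)) + t * (t * (norm ?D)\<^sup>2) + t * (lam * (nuclear_norm B - nuclear_norm A))"
    using min[of ?C] by (simp add: algebra_simps)
  also have "\<dots> = t * (2 * (?R \<bullet> ?D) + lam * (nuclear_norm B - nuclear_norm A) + t * (norm ?D)\<^sup>2)"
    by (simp add: algebra_simps)
  finally show "0 \<le> 2 * (?R \<bullet> ?D) + lam * (nuclear_norm B - nuclear_norm A) + t * (norm ?D)\<^sup>2"
    using t by (simp add: zero_le_mult_iff)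
qed

text \<open>The projection comes from the polar factor of \<open>X\<close>. Its range is orthogonal
  to the kernel of \<open>X\<close>, where the smallest positive singular value bounds
  \<open>X\<close> from below.\<close>

lemma row_space_projection:
  fixes X :: "real^'p^'n"
  obtains P :: "real^'p^'p" where "transpose P = P" "P ** P = P" "X ** P = X"
    and "\<And>x. singular_value X (rank X) * norm (P *v x) \<le> norm (X *v (P *v x))"
proof -
  obtain V :: "real^'p^'n" where V: "X ** (transpose V ** V) = X" "V ** (transpose V ** V) = V"
      "\<And>x. X *v x = 0 \<Longrightarrow> V *v x = 0"
    using polar_factor[of X] by metis
  let ?P = "transpose V ** V"
  have "y \<bullet> (?P *v x) = 0" if "X *v y = 0" for x y
    unfolding gram_inner using V(3)[OF that] by simp
  then have "singular_value X (rank X) * norm (?P *v x) \<le> norm (X *v (?P *v x))" for x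
    by (rule singular_value_rank_le)
  moreover have "transpose ?P = ?P" "?P ** ?P = ?P"
    using V(2) by (simp_all add: matrix_transpose_mul matrix_mul_assoc[symmetric])
  ultimately show thesis using that V(1) by blast
qed

text \<open>The competitor \<open>A\<close> is projected onto the row space along with the
  estimator: its fit is unchanged, its rank does not grow, and the difference \<open>D\<close> lies
  where \<open>X\<close> is bounded below.\<close>

lemma penalized_estimator_oracle_inequality:
  fixes X :: "real^'p^'n" and A0 Ahat A :: "real^'t^'p" and E Y :: "real^'t^'n"
  assumes Y: "Y = X ** A0 + E" and mu: "0 < \<mu>"
    and sX: "singular_value X (rank X) \<ge> 1 / \<mu>"
    and lam: "lam \<ge> 2 * singular_value (transpose X ** E) 1"
    and min: "\<And>C. (norm (Y - X ** Ahat))\<^sup>2 + lam * nuclear_norm Ahat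
      \<le> (norm (Y - X ** C))\<^sup>2 + lam * nuclear_norm C"
  shows "(norm (X ** Ahat - X ** A0))\<^sup>2
    \<le> (norm (X ** A - X ** A0))\<^sup>2 + 3 / 2 * \<mu>\<^sup>2 * lam\<^sup>2 * real (rank A)"
proof -
  obtain P :: "real^'p^'p" where P: "transpose P = P" "P ** P = P" "X ** P = X"
      and XP: "\<And>x. singular_value X (rank X) * norm (P *v x) \<le> norm (X *v (P *v x))"
    using row_space_projection by blast
  have lam0: "0 \<le> lam" using lam singular_value_nonneg[of 1 "transpose X ** E"] by simp
  define A1 where "A1 = P ** Ahat"
  define A2 where "A2 = P ** A"
  define D where "D = A1 - A2"
  define M where "M = transpose X ** E"
  define H where "H = X ** Ahat - X ** A0"
  have XA: "X ** A1 = X ** Ahat" "X ** A2 = X ** A"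
    by (simp_all add: A1_def A2_def matrix_mul_assoc P)
  have "nuclear_norm A1 \<le> nuclear_norm Ahat"
    unfolding A1_def by (rule nuclear_norm_mult_le) (rule symmetric_idempotent_pythagoras(3)[OF P(1,2)])
  then have "lam * nuclear_norm A1 \<le> lam * nuclear_norm Ahat" using lam0 by (rule mult_left_mono)
  then have "(norm (Y - X ** A1))\<^sup>2 + lam * nuclear_norm A1
      \<le> (norm (Y - X ** C))\<^sup>2 + lam * nuclear_norm C" for C
    using min[of C] by (simp add: XA)
  then have var: "0 \<le> 2 * ((Y - X ** A1) \<bullet> (X ** D)) + lam * (nuclear_norm A2 - nuclear_norm A1)"
    unfolding D_def by (rule penalized_minimizer_variational_inequality[OF _ lam0])
  have "Y - X ** A1 = E - H" by (simp add: Y XA H_def)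
  moreover have "E \<bullet> (X ** D) = M \<bullet> D"
    using inner_matrix_mult_left[of X D E] by (simp add: M_def inner_commute)
  ultimately have "2 * (H \<bullet> (X ** D)) \<le> lam * (nuclear_norm A2 - nuclear_norm (A2 + D)) + 2 * (M \<bullet> D)"
    using var by (simp add: inner_diff_left D_def)
  also have "\<dots> \<le> sqrt (6 * real (rank A2)) * lam * norm D"
  proof (rule nuclear_norm_perturbation[OF _ lam0])
    fix x
    have "norm (M *v x) \<le> singular_value M 1 * norm x" by (rule norm_mult_le_singular_value_1)
    also have "\<dots> \<le> lam / 2 * norm x" using lam by (intro mult_right_mono) (auto simp: M_def)
    finally show "norm (M *v x) \<le> lam / 2 * norm x" .
  qed
  also have "\<dots> \<le> sqrt (6 * real (rank A)) * lam * (\<mu> * norm (X ** D))"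
  proof (intro mult_mono)
    show "sqrt (6 * real (rank A2)) \<le> sqrt (6 * real (rank A))"
      using rank_mul_le_right[of P A] by (simp add: A2_def)
    have PD: "P ** D = D"
      by (simp add: D_def A1_def A2_def matrix_diff_ldistrib matrix_mul_assoc P)
    \<comment> \<open>\<open>D\<close> is compared with \<open>X ** D\<close> column by column in an
      orthonormal basis; \<open>mat 1\<close> puts \<open>D\<close> into the form of a
      product.\<close>
    have "norm ((mat 1 :: real^'p^'p) ** D) \<le> norm ((\<mu> *\<^sub>R X) ** D)"
    proof (rule norm_matrix_mult_mono)
      fix x
      have Dx: "P *v (D *v x) = D *v x" by (simp add: matrix_vector_mul_assoc PD)
      have "1 / \<mu> * norm (D *v x) \<le> norm (X *v (D *v x))"
        using XP[of "D *v x"] mult_right_mono[OF sX norm_ge_zero[of "D *v x"]] by (simp add: Dx)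
      then have "norm (D *v x) \<le> \<mu> * norm (X *v (D *v x))"
        using mu by (simp add: field_simps)
      then show "norm ((mat 1 :: real^'p^'p) *v (D *v x)) \<le> norm ((\<mu> *\<^sub>R X) *v (D *v x))"
        using mu by (simp add: scaleR_matrix_vector_assoc[symmetric])
    qed
    then show "norm D \<le> \<mu> * norm (X ** D)"
      using mu by (simp add: scalar_matrix_assoc[symmetric])
  qed (use lam0 in auto)
  \<comment> \<open>The product is split by \<open>2 * a * b \<le> a\<^sup>2 + b\<^sup>2\<close>.
    The square of the first factor is the oracle term, with 6 / 4 = 3 / 2; the square of
    \<open>norm (X ** D)\<close> is the one that appears on expanding the square of
    \<open>H - X ** D\<close>.\<close>
  also have "\<dots> = 2 * ((sqrt (6 * real (rank A)) * lam * \<mu> / 2) * norm (X ** D))" by simp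
  also have "\<dots> \<le> (sqrt (6 * real (rank A)) * lam * \<mu> / 2)\<^sup>2 + (norm (X ** D))\<^sup>2"
    using sum_squares_bound[of "sqrt (6 * real (rank A)) * lam * \<mu> / 2" "norm (X ** D)"] by simp
  also have "(sqrt (6 * real (rank A)) * lam * \<mu> / 2)\<^sup>2 = 3 / 2 * \<mu>\<^sup>2 * lam\<^sup>2 * real (rank A)"
    by (simp add: power_mult_distrib power_divide)
  finally have "2 * (H \<bullet> (X ** D)) \<le> 3 / 2 * \<mu>\<^sup>2 * lam\<^sup>2 * real (rank A) + (norm (X ** D))\<^sup>2" .
  moreover have "X ** A - X ** A0 = H - X ** D"
    by (simp add: H_def D_def matrix_diff_ldistrib XA)
  then have "(norm (X ** A - X ** A0))\<^sup>2 = (norm H)\<^sup>2 - 2 * (H \<bullet> (X ** D)) + (norm (X ** D))\<^sup>2"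
    by (simp add: power2_norm_eq_inner inner_diff_left inner_diff_right inner_commute)
  ultimately show ?thesis by (simp add: H_def)
qed

theorem theorem1:
  fixes X :: "real^'p^'n" and A0 :: "real^'t^'p" and E Y :: "real^'t^'n"
    and Ahat :: "real^'t^'p" and \<mu> lam :: real
  assumes "X \<noteq> 0"
    and "Y = X ** A0 + E"
    and "\<mu> > 0"
    and "singular_value X (rank X) \<ge> 1 / \<mu>"
    and "lam \<ge> 2 * singular_value (transpose X ** E) 1"
    and "is_arg_min
           (\<lambda>A :: real^'t^'p. (norm (Y - X ** A))\<^sup>2
              + lam * (\<Sum>k = 1..min CARD('p) CARD('t). singular_value A k))
           (\<lambda>A. A \<in> UNIV) Ahat"
  shows "(norm (X ** Ahat - X ** A0))\<^sup>2
           \<le> (INF A :: real^'t^'p. (norm (X ** A - X ** A0))\<^sup>2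
                + 3 / 2 * \<mu>\<^sup>2 * lam\<^sup>2 * real (rank A))
         \<and> (INF A :: real^'t^'p. (norm (X ** A - X ** A0))\<^sup>2
                + 3 / 2 * \<mu>\<^sup>2 * lam\<^sup>2 * real (rank A))
           = (INF r \<in> {0..min CARD('p) CARD('t)}.
                (\<Sum>k = r + 1..min CARD('n) CARD('t). (singular_value (X ** A0) k)\<^sup>2)
                + 3 / 2 * \<mu>\<^sup>2 * lam\<^sup>2 * real r)"
proof -
  define f where "f A = (norm (X ** A - X ** A0))\<^sup>2 + 3 / 2 * \<mu>\<^sup>2 * lam\<^sup>2 * real (rank A)"
    for A :: "real^'t^'p"
  define g where "g r = (\<Sum>k = r + 1..min CARD('n) CARD('t). (singular_value (X ** A0) k)\<^sup>2)
                + 3 / 2 * \<mu>\<^sup>2 * lam\<^sup>2 * real r" for r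
  have min: "(norm (Y - X ** Ahat))\<^sup>2 + lam * nuclear_norm Ahat
      \<le> (norm (Y - X ** C))\<^sup>2 + lam * nuclear_norm C" for C
    using assms(6) by (simp add: is_arg_min_linorder nuclear_norm_def)
  have "(norm (X ** Ahat - X ** A0))\<^sup>2 \<le> (INF A. f A)"
    unfolding f_def
    by (intro cINF_greatest penalized_estimator_oracle_inequality[OF assms(2-5) min]) simp
  \<comment> \<open>Each value of \<open>g\<close> dominates a value of \<open>f\<close>, by
    truncation of \<open>X ** A0\<close>, and each value of \<open>f\<close> dominates the value of
    \<open>g\<close> at the rank of the matrix, by the lower bound for low-rank
    approximation.\<close>
  moreover have "(INF A. f A) = (INF r\<in>{0..min CARD('p) CARD('t)}. g r)"
  proof (rule antisym; rule cINF_mono)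
    show "bdd_below (range f)"
      by (rule bdd_belowI2[of _ 0]) (simp add: f_def)
    show "bdd_below (g ` {0..min CARD('p) CARD('t)})" by simp
    show "\<exists>A\<in>UNIV. f A \<le> g r" if r: "r \<in> {0..min CARD('p) CARD('t)}" for r
    proof -
      obtain Q :: "real^'t^'t" where Q: "rank Q \<le> r"
          "(norm ((X ** A0) ** Q - X ** A0))\<^sup>2
            = (\<Sum>k = r + 1..min CARD('n) CARD('t). (singular_value (X ** A0) k)\<^sup>2)"
        using truncated_svd[of r "X ** A0"] r by auto
      have "rank (A0 ** Q) \<le> r" using rank_mul_le_right[of A0 Q] Q(1) by simp
      then have "3 / 2 * \<mu>\<^sup>2 * lam\<^sup>2 * real (rank (A0 ** Q)) \<le> 3 / 2 * \<mu>\<^sup>2 * lam\<^sup>2 * real r"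
        by (intro mult_left_mono) auto
      then have "f (A0 ** Q) \<le> g r"
        using Q(2) by (simp add: f_def g_def matrix_mul_assoc)
      then show ?thesis by blast
    qed
    show "\<exists>r\<in>{0..min CARD('p) CARD('t)}. g r \<le> f A" for A
    proof
      show "rank A \<in> {0..min CARD('p) CARD('t)}" using rank_bound[of A] by simp
      show "g (rank A) \<le> f A"
        unfolding f_def g_def
        by (intro add_right_mono eckart_young_lower_bound rank_mul_le_right)
    qed
  qed auto
  ultimately show ?thesis by (simp add: f_def g_def)
qed

end
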